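(* Let $n\ge 4$ and let $w$ be a proper quasi-Coxeter element of the Coxeter group $W$ of type $D_n$. Then the poset $([1,w],\preceq)$ is not a lattice.
   Context: Let $T$ be the set of all reflections of $W$ (all conjugates of the simple reflections), and for $v\in W$ let $\ell_T(v)$ be the least $k$ such that $v$ is a product of $k$ elements of $T$. A reduced decomposition of $v$ is an expression $v=t_1\cdots t_k$ with $t_i\in T$ and $k=\ell_T(v)$. The absolute order is $v\preceq w$ iff $\ell_T(w)=\ell_T(v)+\ell_T(v^{-1}w)$, and $[1,w]=\{v\in W: v\preceq w\}$. An element $w\in W$ is a quasi-Coxeter element if it has a reduced decomposition $w=t_1\cdots t_n$ ($n$ the rank of $W$) with $\langle t_1,\dots,t_n\rangle=W$. A Coxeter element is a conjugate of a product of all simple reflections in some order; a quasi-Coxeter element is proper if it is not a Coxeter element. *)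

theory Defs
  imports "HOL-Algebra.Algebra"
begin

section \<open>Coxeter systems\<close>

text \<open>
  In a Coxeter matrix \<open>M\<close> over the index set \<open>I\<close>, the entry \<open>0\<close> stands for
  \<open>m(i,j) = \<infinity>\<close>, that is, for the absence of a relation.
\<close>

definition coxeter_matrix :: "'i set \<Rightarrow> ('i \<Rightarrow> 'i \<Rightarrow> nat) \<Rightarrow> bool" where
  "coxeter_matrix I M \<longleftrightarrow>
     (\<forall>i\<in>I. M i i = 1) \<and>
     (\<forall>i\<in>I. \<forall>j\<in>I. M i j = M j i) \<and>
     (\<forall>i\<in>I. \<forall>j\<in>I. i \<noteq> j \<longrightarrow> M i j \<noteq> 1)"

text \<open>
  Equality of words in the group with generators \<open>I\<close> and one relator \<open>(i j)\<^bsup>M i j\<^esup>\<close> for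
  each pair of generators.  The relators \<open>(i i)\<^sup>1\<close> make every generator an involution, so the monoid presented by these
  relations is already the group, and words without formal inverses suffice.
\<close>

inductive coxeter_word_eq :: "'i set \<Rightarrow> ('i \<Rightarrow> 'i \<Rightarrow> nat) \<Rightarrow> 'i list \<Rightarrow> 'i list \<Rightarrow> bool"
  for I :: "'i set" and M :: "'i \<Rightarrow> 'i \<Rightarrow> nat" where
  relator: "i \<in> I \<Longrightarrow> j \<in> I \<Longrightarrow> coxeter_word_eq I M (concat (replicate (M i j) [i, j])) []"
| refl: "u \<in> lists I \<Longrightarrow> coxeter_word_eq I M u u"
| sym: "coxeter_word_eq I M u v \<Longrightarrow> coxeter_word_eq I M v u"
| trans: "coxeter_word_eq I M u v \<Longrightarrow> coxeter_word_eq I M v x \<Longrightarrow> coxeter_word_eq I M u x"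
| cong: "x \<in> lists I \<Longrightarrow> y \<in> lists I \<Longrightarrow> coxeter_word_eq I M u v
    \<Longrightarrow> coxeter_word_eq I M (x @ u @ y) (x @ v @ y)"

definition list_mult :: "('a, 'b) monoid_scheme \<Rightarrow> 'a list \<Rightarrow> 'a" where
  "list_mult G xs = foldr (\<lambda>x y. x \<otimes>\<^bsub>G\<^esub> y) xs \<one>\<^bsub>G\<^esub>"

text \<open>
  \<open>G\<close> is generated by the family \<open>s\<close>, and the products of two words in the generators
  agree exactly when the defining relations force them to: \<open>G\<close> is presented by \<open>M\<close>.
\<close>

locale coxeter_system = group G
  for G :: "('a, 'b) monoid_scheme" (structure)
    and I :: "'i set" and M :: "'i \<Rightarrow> 'i \<Rightarrow> nat" and s :: "'i \<Rightarrow> 'a" +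
  assumes coxeter_matrix: "coxeter_matrix I M"
    and simple_closed: "i \<in> I \<Longrightarrow> s i \<in> carrier G"
    and simple_generate: "generate G (s ` I) = carrier G"
    and presentation: "\<lbrakk>u \<in> lists I; v \<in> lists I\<rbrakk> \<Longrightarrow>
      list_mult G (map s u) = list_mult G (map s v) \<longleftrightarrow> coxeter_word_eq I M u v"

text \<open>
  Diagram \<open>D\<^sub>n\<close> on the nodes \<open>0, \<dots>, n - 1\<close>: the path \<open>0 - 1 - \<dots> - (n - 2)\<close> together
  with the edge joining \<open>n - 3\<close> and \<open>n - 1\<close>.
\<close>

definition type_D_edges :: "nat \<Rightarrow> nat set set" where
  "type_D_edges n = {{k, k + 1} | k. k + 2 < n} \<union> {{n - 3, n - 1}}"

definition type_D :: "nat \<Rightarrow> nat \<Rightarrow> nat \<Rightarrow> nat" where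
  "type_D n i j = (if i = j then 1 else if {i, j} \<in> type_D_edges n then 3 else 2)"


section \<open>Reflections and the absolute order\<close>

definition reflections :: "('a, 'b) monoid_scheme \<Rightarrow> 'i set \<Rightarrow> ('i \<Rightarrow> 'a) \<Rightarrow> 'a set" where
  "reflections G I s = {g \<otimes>\<^bsub>G\<^esub> s i \<otimes>\<^bsub>G\<^esub> inv\<^bsub>G\<^esub> g | g i. g \<in> carrier G \<and> i \<in> I}"

definition word_length :: "('a, 'b) monoid_scheme \<Rightarrow> 'a set \<Rightarrow> 'a \<Rightarrow> nat" where
  "word_length G T v = (LEAST k. \<exists>ts \<in> lists T. length ts = k \<and> list_mult G ts = v)"

definition reduced_decomposition ::
    "('a, 'b) monoid_scheme \<Rightarrow> 'a set \<Rightarrow> 'a \<Rightarrow> 'a list \<Rightarrow> bool" where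
  "reduced_decomposition G T v ts \<longleftrightarrow>
     ts \<in> lists T \<and> list_mult G ts = v \<and> length ts = word_length G T v"

definition absolute_le :: "('a, 'b) monoid_scheme \<Rightarrow> 'a set \<Rightarrow> 'a \<Rightarrow> 'a \<Rightarrow> bool" where
  "absolute_le G T v w \<longleftrightarrow>
     word_length G T w = word_length G T v + word_length G T (inv\<^bsub>G\<^esub> v \<otimes>\<^bsub>G\<^esub> w)"

definition absolute_interval :: "('a, 'b) monoid_scheme \<Rightarrow> 'a set \<Rightarrow> 'a \<Rightarrow> 'a gorder" where
  "absolute_interval G T w =
     \<lparr>carrier = {v \<in> carrier G. absolute_le G T v w}, eq = (=), le = absolute_le G T\<rparr>"


section \<open>Coxeter and quasi-Coxeter elements\<close>

definition coxeter_element ::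
    "('a, 'b) monoid_scheme \<Rightarrow> 'i set \<Rightarrow> ('i \<Rightarrow> 'a) \<Rightarrow> 'a \<Rightarrow> bool" where
  "coxeter_element G I s w \<longleftrightarrow>
     (\<exists>g \<in> carrier G. \<exists>is. distinct is \<and> set is = I \<and>
        w = g \<otimes>\<^bsub>G\<^esub> list_mult G (map s is) \<otimes>\<^bsub>G\<^esub> inv\<^bsub>G\<^esub> g)"

definition quasi_coxeter_element ::
    "('a, 'b) monoid_scheme \<Rightarrow> 'i set \<Rightarrow> ('i \<Rightarrow> 'a) \<Rightarrow> 'a \<Rightarrow> bool" where
  "quasi_coxeter_element G I s w \<longleftrightarrow>
     w \<in> carrier G \<and>
     (\<exists>ts. reduced_decomposition G (reflections G I s) w ts \<and> length ts = card I \<and>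
        generate G (set ts) = carrier G)"

definition proper_quasi_coxeter_element ::
    "('a, 'b) monoid_scheme \<Rightarrow> 'i set \<Rightarrow> ('i \<Rightarrow> 'a) \<Rightarrow> 'a \<Rightarrow> bool" where
  "proper_quasi_coxeter_element G I s w \<longleftrightarrow>
     quasi_coxeter_element G I s w \<and> \<not> coxeter_element G I s w"


section \<open>The interval is a poset\<close>

text \<open>
  The locale \<^locale>\<open>lattice\<close> includes the axioms of a partial order.  By the lemma
  \<open>absolute_interval_partial_order\<close> below these always hold for the interval, so that its
  not being a lattice really means that some join or meet is missing.
\<close>

context group
begin

lemma list_mult_Nil [simp]: "list_mult G [] = \<one>"
  by (simp add: list_mult_def)

lemma list_mult_Cons [simp]: "list_mult G (x # xs) = x \<otimes> list_mult G xs"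
  by (simp add: list_mult_def)

lemma list_mult_closed: "xs \<in> lists (carrier G) \<Longrightarrow> list_mult G xs \<in> carrier G"
  by (induction xs) auto

lemma list_mult_append:
  "xs \<in> lists (carrier G) \<Longrightarrow> ys \<in> lists (carrier G) \<Longrightarrow>
     list_mult G (xs @ ys) = list_mult G xs \<otimes> list_mult G ys"
  by (induction xs) (auto simp: m_assoc list_mult_closed)

lemma generate_list_mult:
  assumes T: "T \<subseteq> carrier G" and inv: "\<And>t. t \<in> T \<Longrightarrow> inv t \<in> T" and v: "v \<in> generate G T"
  shows "\<exists>ts \<in> lists T. list_mult G ts = v"
  using v
proof (induction rule: generate.induct)
  case one
  show ?case by (rule bexI[of _ "[]"]) auto
next
  case (incl h)
  then show ?case using T by (intro bexI[of _ "[h]"]) auto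
next
  case (inv h)
  then show ?case using T assms(2)[of h] by (intro bexI[of _ "[inv h]"]) auto
next
  case (eng h1 h2)
  then obtain a b where "a \<in> lists T" "list_mult G a = h1" "b \<in> lists T" "list_mult G b = h2"
    by blast
  moreover from this have "a \<in> lists (carrier G)" "b \<in> lists (carrier G)"
    using T by auto
  ultimately show ?case
    by (intro bexI[of _ "a @ b"]) (auto simp: list_mult_append)
qed

lemma partial_order_absolute_interval_aux:
  assumes T: "T \<subseteq> carrier G"
    and gen: "\<And>v. v \<in> carrier G \<Longrightarrow> \<exists>ts \<in> lists T. list_mult G ts = v"
  shows "partial_order (absolute_interval G T w)"
proof -
  let ?l = "word_length G T"
  have ex: "\<exists>ts \<in> lists T. length ts = ?l v \<and> list_mult G ts = v" if "v \<in> carrier G" for v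
    unfolding word_length_def
    by (rule LeastI_ex) (use gen[OF that] in blast)
  have le: "?l v \<le> length ts" if "ts \<in> lists T" "list_mult G ts = v" for v ts
    unfolding word_length_def by (rule Least_le) (use that in blast)
  have one: "?l \<one> = 0"
    using le[of "[]" \<one>] by simp
  have zero: "v = \<one>" if "v \<in> carrier G" "?l v = 0" for v
    using ex[OF that(1)] that(2) by auto
  have sub: "?l (a \<otimes> b) \<le> ?l a + ?l b" if ab: "a \<in> carrier G" "b \<in> carrier G" for a b
  proof -
    obtain x where x: "x \<in> lists T" "length x = ?l a" "list_mult G x = a"
      using ex[OF ab(1)] by blast
    obtain y where y: "y \<in> lists T" "length y = ?l b" "list_mult G y = b"
      using ex[OF ab(2)] by blast
    have "x \<in> lists (carrier G)" "y \<in> lists (carrier G)"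
      using x(1) y(1) T by auto
    then have "list_mult G (x @ y) = a \<otimes> b"
      using x y by (simp add: list_mult_append)
    then show ?thesis
      using le[of "x @ y" "a \<otimes> b"] x y by auto
  qed
  have antisym: "u = v"
    if "u \<in> carrier G" "v \<in> carrier G" "absolute_le G T u v" "absolute_le G T v u" for u v
  proof -
    have "?l (inv u \<otimes> v) = 0"
      using that unfolding absolute_le_def by linarith
    then have "inv u \<otimes> v = \<one>"
      using zero that by simp
    then show ?thesis
      using that by (metis inv_closed inv_equality inv_inv)
  qed
  have trans: "absolute_le G T u x"
    if c: "u \<in> carrier G" "v \<in> carrier G" "x \<in> carrier G"
      and uv: "absolute_le G T u v" and vx: "absolute_le G T v x" for u v x
  proof -
    have "(inv u \<otimes> v) \<otimes> (inv v \<otimes> x) = inv u \<otimes> x"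
      using c by (metis inv_closed inv_solve_left m_assoc m_closed)
    then have 1: "?l (inv u \<otimes> x) \<le> ?l (inv u \<otimes> v) + ?l (inv v \<otimes> x)"
      using sub[of "inv u \<otimes> v" "inv v \<otimes> x"] c by simp
    have "u \<otimes> (inv u \<otimes> x) = x"
      using c by (metis inv_closed l_one m_assoc r_inv)
    then have "?l x \<le> ?l u + ?l (inv u \<otimes> x)"
      using sub[of u "inv u \<otimes> x"] c by simp
    with 1 uv vx show ?thesis
      unfolding absolute_le_def by linarith
  qed
  show ?thesis
    by unfold_locales
      (auto simp: absolute_interval_def intro: antisym trans, auto simp: absolute_le_def one)
qed

end

context coxeter_system
begin

lemma simple_square: "i \<in> I \<Longrightarrow> s i \<otimes> s i = \<one>"
  using presentation[of "[i, i]" "[]"] coxeter_word_eq.relator[of i I i M]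
    coxeter_matrix simple_closed[of i]
  by (simp add: coxeter_matrix_def)

lemma reflections_closed: "reflections G I s \<subseteq> carrier G"
  by (auto simp: reflections_def simple_closed)

lemma reflections_inv: "t \<in> reflections G I s \<Longrightarrow> inv t \<in> reflections G I s"
proof -
  assume "t \<in> reflections G I s"
  then obtain g i where g: "g \<in> carrier G" "i \<in> I" "t = g \<otimes> s i \<otimes> inv g"
    by (auto simp: reflections_def)
  have "inv (s i) = s i"
    using g simple_square simple_closed by (metis inv_equality)
  then have "inv t = g \<otimes> s i \<otimes> inv g"
    using g simple_closed by (simp add: inv_mult_group m_assoc)
  then show ?thesis using g by (auto simp: reflections_def)
qed

lemma simple_reflection: "s ` I \<subseteq> reflections G I s"
proof
  fix t assume "t \<in> s ` I"
  then obtain i where "i \<in> I" "t = s i" by blast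
  then have "t = \<one> \<otimes> s i \<otimes> inv \<one>" by (simp add: simple_closed)
  then show "t \<in> reflections G I s"
    using \<open>i \<in> I\<close> unfolding reflections_def by blast
qed

lemma reflections_generate: "v \<in> carrier G \<Longrightarrow> \<exists>ts \<in> lists (reflections G I s). list_mult G ts = v"
  using generate_list_mult[OF reflections_closed reflections_inv]
    mono_generate[OF simple_reflection] simple_generate by blast

theorem absolute_interval_partial_order:
  "partial_order (absolute_interval G (reflections G I s) w)"
  by (rule partial_order_absolute_interval_aux[OF reflections_closed reflections_generate])

end

end

theory Submission
  imports Defs
begin

text \<open>
  Write \<open>W\<close> as the group of even signed permutations of \<open>\<plusminus>1, \<dots>, \<plusminus>n\<close>; that this representation is faithful follows
  from the fact that an element lengthened by a simple reflection maps the corresponding root to a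
  positive root.  If \<open>w\<close> is a product of \<open>n\<close> reflections generating \<open>W\<close>, then these reflections act transitively on the
  \<open>2n\<close> signed points, and the Riemann--Hurwitz inequality for their \<open>2n\<close> transpositions leaves \<open>w\<close> at most two
  cycles.  Parity and reducedness then force \<open>w\<close> to consist of two negative cycles.  If one of them is a
  fixed letter with a sign change, \<open>w\<close> is a Coxeter element.  Otherwise let \<open>c\<close>, \<open>a\<close> be consecutive in one cycle and \<open>d\<close>, \<open>b\<close> in the
  other.  The commuting reflections in \<open>e\<^sub>c - e\<^sub>a\<close> and \<open>e\<^sub>c + e\<^sub>a\<close> lie below two different elements of length 3 in
  the interval, namely the negative cycle \<open>(c a)\<close> times the sign change of \<open>b\<close> or of \<open>d\<close>.  A join would have length 2, hence be
  the sign change of both \<open>c\<close> and \<open>a\<close>; but removing that from \<open>w\<close> leaves two negative cycles, so it is not below \<open>w\<close>.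
\<close>

section \<open>Signed permutations\<close>

text \<open>The group is known only through its presentation, whereas lengths are estimated by
  counting orbits of permutations of \<open>2n\<close> points. Faithfulness links the two: a
  factorization of the permutation into reflections lifts to the group and bounds the absolute
  length from above. For the orbit counts, note that a positive cycle contributes two orbits and a
  negative cycle one, and that a reflection is a product of two transpositions. So \<open>k\<close>
  reflections leave at least \<open>2n - 2k\<close> orbits. This bound decides the last step: an
  element of length 2 below \<open>w\<close> has a complement of length \<open>n - 2\<close>, hence
  with at least four orbits, while removing the double sign change leaves at most two. The length of
  a join is pinned to 2 because it lies above two different reflections and below two different
  elements of length 3, and comparable elements of equal length coincide.\<close>

definition pts :: "nat \<Rightarrow> int set" where
  "pts n = {x. x \<noteq> 0 \<and> \<bar>x\<bar> \<le> int n}"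

text \<open>This is the hyperoctahedral group, of type B; the evenness that singles out type D is
  not built in and enters through \<open>sign_rprod\<close>.\<close>

definition signed_perm :: "nat \<Rightarrow> (int \<Rightarrow> int) \<Rightarrow> bool" where
  "signed_perm n g \<longleftrightarrow> g permutes pts n \<and> (\<forall>x. g (- x) = - g x)"

text \<open>With \<open>e_(-a) = - e_a\<close> this is the reflection in \<open>e_a - e_b\<close>.
  Signed arguments cover both families of roots of type D: \<open>sswap a (- b)\<close> is the
  reflection in \<open>e_a + e_b\<close>.\<close>

definition sswap :: "int \<Rightarrow> int \<Rightarrow> int \<Rightarrow> int" where
  "sswap a b x = (if x = a then b else if x = b then a
     else if x = - a then - b else if x = - b then - a else x)"

text \<open>Excluding \<open>\<bar>a\<bar> = \<bar>b\<bar>\<close> rules out the pair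
  \<open>(a, - a)\<close>, whose swap is a single sign change and not an element of type D. A
  reflection is named by four pairs: \<open>(a, b)\<close>, \<open>(b, a)\<close>,
  \<open>(- a, - b)\<close> and \<open>(- b, - a)\<close>.\<close>

definition roots :: "nat \<Rightarrow> (int \<times> int) set" where
  "roots n = {(a, b). a \<in> pts n \<and> b \<in> pts n \<and> \<bar>a\<bar> \<noteq> \<bar>b\<bar>}"

definition rprod :: "(int \<times> int) list \<Rightarrow> int \<Rightarrow> int" where
  "rprod ps = foldr (\<lambda>p f. sswap (fst p) (snd p) \<circ> f) ps id"

lemma rprod_simps [simp]:
  "rprod [] = id" "rprod (p # ps) = sswap (fst p) (snd p) \<circ> rprod ps"
  by (simp_all add: rprod_def)

lemma rprod_append: "rprod (ps @ qs) = rprod ps \<circ> rprod qs"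
  by (induction ps) auto

lemma finite_pts [simp]: "finite (pts n)"
  by (rule finite_subset[of _ "{- int n..int n}"]) (auto simp: pts_def)

lemma pts_uminus [simp]: "- x \<in> pts n \<longleftrightarrow> x \<in> pts n"
  by (simp add: pts_def)

lemma zero_notin_pts [simp]: "0 \<notin> pts n"
  by (simp add: pts_def)

lemma card_pts: "card (pts n) = 2 * n"
proof -
  have "pts n = {1..int n} \<union> uminus ` {1..int n}"
  proof (intro equalityI subsetI)
    fix x assume "x \<in> pts n"
    then show "x \<in> {1..int n} \<union> uminus ` {1..int n}"
      by (cases "x > 0") (auto simp: pts_def image_iff intro: bexI[of _ "- x"])
  qed (auto simp: pts_def)
  moreover have "{1..int n} \<inter> uminus ` {1..int n} = {}" by auto
  ultimately show ?thesis
    by (simp add: card_Un_disjoint card_image)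
qed

lemma sswap_commute: "a \<noteq> 0 \<Longrightarrow> b \<noteq> 0 \<Longrightarrow> \<bar>a\<bar> \<noteq> \<bar>b\<bar> \<Longrightarrow> sswap a b = sswap b a"
  by (auto simp: sswap_def fun_eq_iff)

lemma sswap_uminus: "a \<noteq> 0 \<Longrightarrow> b \<noteq> 0 \<Longrightarrow> \<bar>a\<bar> \<noteq> \<bar>b\<bar> \<Longrightarrow> sswap (- a) (- b) = sswap a b"
  by (auto simp: sswap_def fun_eq_iff)

lemma sswap_eq_transpose:
  "a \<noteq> 0 \<Longrightarrow> b \<noteq> 0 \<Longrightarrow> \<bar>a\<bar> \<noteq> \<bar>b\<bar> \<Longrightarrow> sswap a b = transpose a b \<circ> transpose (- a) (- b)"
  by (auto simp: sswap_def fun_eq_iff transpose_def)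

lemma sswap_sswap [simp]: "a \<noteq> 0 \<Longrightarrow> b \<noteq> 0 \<Longrightarrow> \<bar>a\<bar> \<noteq> \<bar>b\<bar> \<Longrightarrow> sswap a b (sswap a b x) = x"
  by (auto simp: sswap_def)

lemma sswap_o_sswap: "a \<noteq> 0 \<Longrightarrow> b \<noteq> 0 \<Longrightarrow> \<bar>a\<bar> \<noteq> \<bar>b\<bar> \<Longrightarrow> sswap a b \<circ> sswap a b = id"
  by (auto simp: fun_eq_iff)

lemma sswap_odd: "a \<noteq> 0 \<Longrightarrow> b \<noteq> 0 \<Longrightarrow> \<bar>a\<bar> \<noteq> \<bar>b\<bar> \<Longrightarrow> sswap a b (- x) = - sswap a b x"
  by (auto simp: sswap_def)

lemma sswap_other: "\<bar>z\<bar> \<noteq> \<bar>a\<bar> \<Longrightarrow> \<bar>z\<bar> \<noteq> \<bar>b\<bar> \<Longrightarrow> sswap a b z = z"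
  by (auto simp: sswap_def)

lemma sswap_apply: "a \<noteq> 0 \<Longrightarrow> b \<noteq> 0 \<Longrightarrow> \<bar>a\<bar> \<noteq> \<bar>b\<bar> \<Longrightarrow>
    sswap a b a = b \<and> sswap a b b = a \<and> sswap a b (- a) = - b \<and> sswap a b (- b) = - a"
  by (auto simp: sswap_def)

lemma rootsD:
  assumes "(a, b) \<in> roots n"
  shows "a \<in> pts n" "b \<in> pts n" "a \<noteq> 0" "b \<noteq> 0" "\<bar>a\<bar> \<noteq> \<bar>b\<bar>"
  using assms by (auto simp: roots_def pts_def)

lemma signed_perm_sswap:
  assumes "(a, b) \<in> roots n"
  shows "signed_perm n (sswap a b)"
proof -
  note r = rootsD[OF assms]
  have "sswap a b permutes pts n"
    unfolding sswap_eq_transpose[OF r(3-5)]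
    using r by (intro permutes_compose permutes_swap_id) auto
  then show ?thesis
    using r by (simp add: signed_perm_def sswap_odd)
qed

lemma signed_perm_id: "signed_perm n id"
  by (simp add: signed_perm_def permutes_id)

lemma signed_perm_comp: "signed_perm n f \<Longrightarrow> signed_perm n g \<Longrightarrow> signed_perm n (f \<circ> g)"
  by (simp add: signed_perm_def permutes_compose)

lemma signed_perm_rprod: "set ps \<subseteq> roots n \<Longrightarrow> signed_perm n (rprod ps)"
proof (induction ps)
  case (Cons p ps)
  then show ?case
    by (cases p) (simp add: signed_perm_comp signed_perm_sswap del: comp_apply)
qed (simp add: signed_perm_id)

lemma signed_perm_odd: "signed_perm n f \<Longrightarrow> f (- x) = - f x"
  by (simp add: signed_perm_def)

lemma signed_perm_inj: "signed_perm n f \<Longrightarrow> f x = f y \<longleftrightarrow> x = y"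
  unfolding signed_perm_def by (metis permutes_inv_eq)

lemma signed_perm_pts: "signed_perm n f \<Longrightarrow> f x \<in> pts n \<longleftrightarrow> x \<in> pts n"
  by (simp add: signed_perm_def permutes_in_image)

lemma signed_perm_fix: "signed_perm n f \<Longrightarrow> x \<notin> pts n \<Longrightarrow> f x = x"
  by (auto simp: signed_perm_def dest: permutes_not_in)

lemma signed_perm_abs: "signed_perm n f \<Longrightarrow> \<bar>f x\<bar> = \<bar>f y\<bar> \<longleftrightarrow> \<bar>x\<bar> = \<bar>y\<bar>"
  unfolding abs_eq_iff signed_perm_odd[symmetric] signed_perm_inj ..



lemma signed_perm_roots: "signed_perm n f \<Longrightarrow> (f a, f b) \<in> roots n \<longleftrightarrow> (a, b) \<in> roots n"
  by (auto simp: roots_def signed_perm_pts signed_perm_abs)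

lemma signed_perm_permutation: "signed_perm n f \<Longrightarrow> permutation f"
  unfolding signed_perm_def permutation_permutes using finite_pts by blast

lemma signed_perm_sswap_conj:
  assumes "signed_perm n f"
  shows "f \<circ> sswap a b = sswap (f a) (f b) \<circ> f"
  by (auto simp: fun_eq_iff sswap_def signed_perm_inj[OF assms]
      signed_perm_odd[OF assms, symmetric])

lemma sign_sswap: "a \<noteq> 0 \<Longrightarrow> b \<noteq> 0 \<Longrightarrow> \<bar>a\<bar> \<noteq> \<bar>b\<bar> \<Longrightarrow> sign (sswap a b) = 1"
  by (simp add: sswap_eq_transpose sign_compose permutation_swap_id sign_swap_id)

text \<open>A signed permutation is odd on the \<open>2n\<close> points exactly if it changes an odd
  number of signs, so this is the evenness condition of type D.\<close>

lemma sign_rprod: "set ps \<subseteq> roots n \<Longrightarrow> sign (rprod ps) = 1"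
proof (induction ps)
  case (Cons p ps)
  then have "(fst p, snd p) \<in> roots n" by auto
  moreover from this have "permutation (sswap (fst p) (snd p))"
    by (rule signed_perm_permutation[OF signed_perm_sswap])
  moreover have "permutation (rprod ps)"
    using Cons.prems by (auto intro!: signed_perm_permutation[of n] signed_perm_rprod)
  ultimately show ?case
    using Cons.IH Cons.prems rootsD[OF \<open>(fst p, snd p) \<in> roots n\<close>]
    by (simp add: sign_compose sign_sswap del: comp_apply)
qed simp

section \<open>Products of transpositions\<close>

text \<open>Relations live on the whole type, so that no closure under \<open>P\<close> has to be
  carried along; only classes meeting \<open>P\<close> are counted.\<close>

definition num_classes :: "'a set \<Rightarrow> ('a \<times> 'a) set \<Rightarrow> nat" where
  "num_classes P E = card ((\<lambda>x. E `` {x}) ` P)"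

text \<open>For an equivalence relation \<open>E\<close>, a closed form of the equivalence relation
  generated by \<open>E\<close> and \<open>(i, j)\<close>; minimality is
  \<open>merge_least\<close>.\<close>

definition merge :: "('a \<times> 'a) set \<Rightarrow> 'a \<Rightarrow> 'a \<Rightarrow> ('a \<times> 'a) set" where
  "merge E i j = E \<union> (E `` {i} \<union> E `` {j}) \<times> (E `` {i} \<union> E `` {j})"

text \<open>The least equivalence relation containing the graph of \<open>f\<close>; for a
  permutation of finite support its classes are the cycles. Written as an intersection, it is
  compared with another relation by checking single steps of \<open>f\<close>.\<close>

definition orbit_rel :: "('a \<Rightarrow> 'a) \<Rightarrow> ('a \<times> 'a) set" where
  "orbit_rel f = {(x, y). \<forall>E. equiv UNIV E \<longrightarrow> (\<forall>z. (z, f z) \<in> E) \<longrightarrow> (x, y) \<in> E}"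

lemma equivD:
  assumes "equiv UNIV E"
  shows "(x, x) \<in> E" "(x, y) \<in> E \<Longrightarrow> (y, x) \<in> E" "(x, y) \<in> E \<Longrightarrow> (y, z) \<in> E \<Longrightarrow> (x, z) \<in> E"
proof -
  have "refl E" "sym E" "trans E" using assms by (auto simp: equiv_def)
  then show "(x, x) \<in> E" "(x, y) \<in> E \<Longrightarrow> (y, x) \<in> E" "(x, y) \<in> E \<Longrightarrow> (y, z) \<in> E \<Longrightarrow> (x, z) \<in> E"
    by (auto simp: refl_on_def dest: symD transD)
qed

lemma equiv_orbit_rel: "equiv UNIV (orbit_rel f)"
proof (rule equivI)
  show "refl (orbit_rel f)"
    by (rule refl_onI) (simp add: orbit_rel_def equivD(1))
  show "sym (orbit_rel f)"
    by (rule symI) (simp add: orbit_rel_def equivD(2))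
  show "trans (orbit_rel f)"
  proof (rule transI)
    fix x y z assume xy: "(x, y) \<in> orbit_rel f" and yz: "(y, z) \<in> orbit_rel f"
    show "(x, z) \<in> orbit_rel f"
      unfolding orbit_rel_def mem_Collect_eq case_prod_conv
    proof (intro allI impI)
      fix E :: "('a \<times> 'a) set" assume E: "equiv UNIV E" "\<forall>z. (z, f z) \<in> E"
      then have "(x, y) \<in> E" "(y, z) \<in> E"
        using xy yz by (auto simp: orbit_rel_def)
      then show "(x, z) \<in> E" by (rule equivD(3)[OF E(1)])
    qed
  qed
qed simp

lemma orbit_rel_step: "(x, f x) \<in> orbit_rel f"
  by (auto simp: orbit_rel_def)

lemma orbit_rel_least: "equiv UNIV E \<Longrightarrow> (\<And>x. (x, f x) \<in> E) \<Longrightarrow> orbit_rel f \<subseteq> E"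
  by (auto simp: orbit_rel_def)

lemma orbit_rel_funpow: "(x, (f ^^ k) x) \<in> orbit_rel f"
proof (induction k)
  case (Suc k)
  then show ?case
    using equivD(3)[OF equiv_orbit_rel _ orbit_rel_step] by fastforce
qed (simp add: equivD[OF equiv_orbit_rel])

lemma equiv_merge:
  assumes "equiv UNIV E"
  shows "equiv UNIV (merge E i j)"
proof -
  note e = equivD[OF assms]
  let ?C = "E `` {i} \<union> E `` {j}"
  have C: "y \<in> ?C" if "x \<in> ?C" "(x, y) \<in> E" for x y
    using that e(3) by blast
  show ?thesis
  proof (rule equivI)
    show "refl (merge E i j)"
      using e(1) by (auto simp: merge_def refl_on_def)
    show "sym (merge E i j)"
      unfolding sym_def merge_def using e(2) by fast
    show "trans (merge E i j)"
    proof (rule transI)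
      fix x y z assume "(x, y) \<in> merge E i j" "(y, z) \<in> merge E i j"
      then consider "(x, y) \<in> E" "(y, z) \<in> E" | "x \<in> ?C" "y \<in> ?C" "(y, z) \<in> E"
        | "(x, y) \<in> E" "y \<in> ?C" "z \<in> ?C" | "x \<in> ?C" "z \<in> ?C"
        unfolding merge_def by fast
      then show "(x, z) \<in> merge E i j"
      proof cases
        case 1
        then show ?thesis using e(3) unfolding merge_def by fast
      next
        case 2
        then show ?thesis using C unfolding merge_def by fast
      next
        case 3
        then show ?thesis using C e(2) unfolding merge_def by fast
      next
        case 4
        then show ?thesis unfolding merge_def by fast
      qed
    qed
  qed simp
qed

lemma in_merge: "equiv UNIV E \<Longrightarrow> (i, j) \<in> merge E i j"
  by (auto simp: merge_def dest: equivD)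

lemma subset_merge: "E \<subseteq> merge E i j"
  by (auto simp: merge_def)

lemma merge_least:
  assumes "equiv UNIV F" "E \<subseteq> F" "(i, j) \<in> F"
  shows "merge E i j \<subseteq> F"
proof -
  note e = equivD[OF assms(1)]
  have "(i, x) \<in> F" if "x \<in> E `` {i} \<union> E `` {j}" for x
    using that assms(2,3) e(3) by blast
  then show ?thesis
    using assms(2) e(2,3) unfolding merge_def by blast
qed

lemma merge_same: "equiv UNIV E \<Longrightarrow> (i, j) \<in> E \<Longrightarrow> merge E i j = E"
  using merge_least[of E E i j] subset_merge[of E i j] by auto

text \<open>Every class of the coarser relation is the image under \<open>F\<close> of a class of
  \<open>E\<close>, so the classes of \<open>E\<close> map onto those of \<open>F\<close>.\<close>

lemma num_classes_mono:
  assumes "finite P" "equiv UNIV E" "equiv UNIV F" "E \<subseteq> F"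
  shows "num_classes P F \<le> num_classes P E"
proof -
  have "F `` {x} = F `` (E `` {x})" for x
    using equivD(1)[OF assms(2)] equivD(3)[OF assms(3)] assms(4) by fast
  then have "(\<lambda>x. F `` {x}) ` P = (\<lambda>A. F `` A) ` (\<lambda>x. E `` {x}) ` P"
    by (simp add: image_image)
  then show ?thesis
    unfolding num_classes_def using assms(1) by (simp add: card_image_le)
qed

lemma num_classes_merge:
  assumes P: "finite P" "i \<in> P" "j \<in> P" and E: "equiv UNIV E" and ij: "(i, j) \<notin> E"
  shows "num_classes P (merge E i j) + 1 = num_classes P E"
proof -
  note e = equivD[OF E]
  let ?A = "E `` {i}" and ?B = "E `` {j}"
  let ?Q = "(\<lambda>x. E `` {x}) ` (P - (?A \<union> ?B))"
  have m: "merge E i j `` {x} = (if x \<in> ?A \<union> ?B then ?A \<union> ?B else E `` {x})" for x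
  proof -
    have "E `` {x} \<subseteq> ?A \<union> ?B" if "x \<in> ?A \<union> ?B"
      using that e(3) by fast
    then show ?thesis unfolding merge_def by auto
  qed
  have A: "E `` {x} = ?A" if "x \<in> ?A" for x
    using that equiv_class_eq[OF E, of i x] by simp
  have B: "E `` {x} = ?B" if "x \<in> ?B" for x
    using that equiv_class_eq[OF E, of j x] by simp
  have i: "i \<in> ?A" "j \<in> ?B" using e(1) by auto
  have "(\<lambda>x. E `` {x}) ` P = insert ?A (insert ?B ?Q)"
  proof (intro equalityI subsetI)
    fix S assume "S \<in> (\<lambda>x. E `` {x}) ` P"
    then obtain x where "x \<in> P" "S = E `` {x}" by blast
    then show "S \<in> insert ?A (insert ?B ?Q)"
      using A[of x] B[of x] by (cases "x \<in> ?A"; cases "x \<in> ?B"; force)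
  next
    fix S assume "S \<in> insert ?A (insert ?B ?Q)"
    then show "S \<in> (\<lambda>x. E `` {x}) ` P" using P by auto
  qed
  moreover have "(\<lambda>x. merge E i j `` {x}) ` P = insert (?A \<union> ?B) ?Q"
  proof (intro equalityI subsetI)
    fix S assume "S \<in> (\<lambda>x. merge E i j `` {x}) ` P"
    then obtain x where "x \<in> P" "S = merge E i j `` {x}" by blast
    then show "S \<in> insert (?A \<union> ?B) ?Q" unfolding m by (auto split: if_splits)
  next
    fix S assume "S \<in> insert (?A \<union> ?B) ?Q"
    then consider "S = ?A \<union> ?B" | x where "x \<in> P - (?A \<union> ?B)" "S = E `` {x}"
      by (elim insertE imageE) auto
    then show "S \<in> (\<lambda>x. merge E i j `` {x}) ` P"
    proof cases
      case 1
      then have "S = merge E i j `` {i}" unfolding m using i by simp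
      then show ?thesis using P(2) by (rule image_eqI)
    next
      case 2
      then have "S = merge E i j `` {x}" unfolding m by auto
      then show ?thesis using 2(1) by (intro image_eqI[of S _ x]) auto
    qed
  qed
  moreover have "?A \<noteq> ?B" using ij i by auto
  moreover have nQ: "S \<notin> ?Q" if "S \<subseteq> ?A \<union> ?B" for S
  proof
    assume "S \<in> ?Q"
    then obtain x where "x \<notin> ?A \<union> ?B" "S = E `` {x}" by blast
    moreover have "x \<in> E `` {x}" using e(1) by simp
    ultimately show False using that by blast
  qed
  moreover have "?A \<notin> ?Q" "?B \<notin> ?Q" "?A \<union> ?B \<notin> ?Q"
    by (rule nQ; simp)+
  moreover have "finite ?Q" using P by simp
  ultimately show ?thesis
    unfolding num_classes_def by simp
qed

lemma num_classes_merge_le: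
  assumes "finite P" "i \<in> P" "j \<in> P" "equiv UNIV E"
  shows "num_classes P E \<le> num_classes P (merge E i j) + 1"
  using assms num_classes_merge[of P i j E] merge_same[of E i j] by (cases "(i, j) \<in> E") auto

text \<open>A step of \<open>f\<close> is a step of the new map followed by a possible jump between
  \<open>i\<close> and \<open>j\<close>. Hence the orbits of \<open>f\<close> refine the new orbits
  after merging at \<open>(i, j)\<close>, and a merge costs at most one class.\<close>

lemma num_classes_orbit_transpose_le:
  assumes "finite P" "i \<in> P" "j \<in> P"
  shows "num_classes P (orbit_rel (transpose i j \<circ> f)) \<le> num_classes P (orbit_rel f) + 1"
proof -
  let ?F = "orbit_rel (transpose i j \<circ> f)"
  let ?M = "merge ?F i j"
  have M: "equiv UNIV ?M" by (simp add: equiv_merge equiv_orbit_rel)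
  have "(x, f x) \<in> ?M" for x
  proof -
    have "(x, transpose i j (f x)) \<in> ?M"
      using orbit_rel_step[of x "transpose i j \<circ> f"] subset_merge by fastforce
    moreover have "(transpose i j y, y) \<in> ?M" for y
      using in_merge[OF equiv_orbit_rel, of i j] equivD(1)[OF M] equivD(2)[OF M, of i j]
      by (simp add: transpose_def)
    ultimately show ?thesis by (rule equivD(3)[OF M])
  qed
  then have "orbit_rel f \<subseteq> ?M"
    by (intro orbit_rel_least M)
  then have "num_classes P ?M \<le> num_classes P (orbit_rel f)"
    by (intro num_classes_mono assms M equiv_orbit_rel)
  then show ?thesis
    using num_classes_merge_le[OF assms equiv_orbit_rel, of "transpose i j \<circ> f"] by simp
qed

text \<open>Walking from \<open>i\<close> along \<open>f\<close> one comes back to \<open>i\<close> without meeting \<open>j\<close>; there the transposition diverts the walk to \<open>j\<close>.\<close>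

lemma orbit_rel_transpose_join:
  assumes f: "permutation f" and ij: "(i, j) \<notin> orbit_rel f"
  shows "(i, j) \<in> orbit_rel (transpose i j \<circ> f)" and
    "f x = i \<Longrightarrow> (x, i) \<in> orbit_rel (transpose i j \<circ> f)"
proof -
  let ?g = "transpose i j \<circ> f"
  note e = equivD[OF equiv_orbit_rel[of ?g]]
  define m where "m = least_power f i"
  have m: "(f ^^ m) i = i" "m > 0"
    using least_power_of_permutation[OF f] by (auto simp: m_def)
  have min: "(f ^^ l) i \<noteq> i" if "0 < l" "l < m" for l
    using that least_power_le[of l f i] by (auto simp: m_def)
  have walk: "(i, (f ^^ l) i) \<in> orbit_rel ?g" if "l < m" for l
    using that
  proof (induction l)
    case 0
    then show ?case by (simp add: e del: comp_apply)
  next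
    case (Suc l)
    have "f ((f ^^ l) i) \<noteq> i" using min[of "Suc l"] Suc.prems by simp
    moreover have "f ((f ^^ l) i) \<noteq> j"
      using orbit_rel_funpow[of i "Suc l" f] ij by auto
    ultimately have "?g ((f ^^ l) i) = (f ^^ Suc l) i" by (simp add: transpose_def)
    then have "((f ^^ l) i, (f ^^ Suc l) i) \<in> orbit_rel ?g"
      using orbit_rel_step[of "(f ^^ l) i" ?g] by simp
    then show ?case
      by (rule e(3)[OF Suc.IH[OF Suc_lessD[OF Suc.prems]]])
  qed
  define y where "y = (f ^^ (m - 1)) i"
  have y: "f y = i" using m by (cases m) (auto simp: y_def)
  have iy: "(i, y) \<in> orbit_rel ?g"
    using walk[of "m - 1"] m by (simp add: y_def)
  moreover have "?g y = j" using y by (simp add: transpose_def)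
  ultimately show "(i, j) \<in> orbit_rel ?g"
    using orbit_rel_step[of y ?g] e(3)[of i y j] by simp
  show "(x, i) \<in> orbit_rel ?g" if "f x = i"
  proof -
    have "x = y"
      using that y permutation_bijective[OF f] by (auto dest: bij_is_inj injD)
    then show ?thesis using e(2)[OF iy] by simp
  qed
qed

text \<open>The diverted steps of \<open>f\<close> are recovered by
  \<open>orbit_rel_transpose_join\<close>, so the new orbit relation contains the old one and also
  the pair \<open>(i, j)\<close>; merging two distinct classes lowers the count by one.\<close>

lemma num_classes_orbit_transpose_join:
  assumes P: "finite P" "i \<in> P" "j \<in> P"
    and f: "permutation f" and ij: "(i, j) \<notin> orbit_rel f"
  shows "num_classes P (orbit_rel (transpose i j \<circ> f)) + 1 \<le> num_classes P (orbit_rel f)"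
proof -
  let ?g = "transpose i j \<circ> f"
  note e = equivD[OF equiv_orbit_rel[of ?g]]
  have ji: "(j, i) \<notin> orbit_rel f" using ij equivD(2)[OF equiv_orbit_rel, of j i] by blast
  have "(x, f x) \<in> orbit_rel ?g" for x
  proof -
    consider "f x = i" | "f x = j" | "?g x = f x"
      by (metis comp_apply transpose_apply_other)
    then show ?thesis
    proof cases
      case 1
      then show ?thesis using orbit_rel_transpose_join(2)[OF f ij] by simp
    next
      case 2
      then show ?thesis
        using orbit_rel_transpose_join(2)[OF f ji] by (simp add: transpose_commute)
    next
      case 3
      then show ?thesis using orbit_rel_step[of x ?g] by simp
    qed
  qed
  then have "orbit_rel f \<subseteq> orbit_rel ?g"
    by (intro orbit_rel_least equiv_orbit_rel)
  then have "merge (orbit_rel f) i j \<subseteq> orbit_rel ?g"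
    by (intro merge_least equiv_orbit_rel orbit_rel_transpose_join(1)[OF f ij])
  then have "num_classes P (orbit_rel ?g) \<le> num_classes P (merge (orbit_rel f) i j)"
    by (intro num_classes_mono P equiv_merge equiv_orbit_rel)
  then show ?thesis
    using num_classes_merge[OF P equiv_orbit_rel ij] by simp
qed

section \<open>Orbit counts for factorizations into transpositions\<close>

definition tprod :: "('a \<times> 'a) list \<Rightarrow> 'a \<Rightarrow> 'a" where
  "tprod ps = foldr (\<lambda>p f. transpose (fst p) (snd p) \<circ> f) ps id"

lemma tprod_simps [simp]:
  "tprod [] = id" "tprod (p # ps) = transpose (fst p) (snd p) \<circ> tprod ps"
  by (simp_all add: tprod_def)

lemma permutation_tprod: "permutation (tprod ps)"
  by (induction ps) (simp_all add: permutation_compose permutation_swap_id del: comp_apply)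

text \<open>The equivalence relation generated by the transposed pairs: its classes are the orbits
  of the group generated by the transpositions.\<close>

definition merges :: "('a \<times> 'a) list \<Rightarrow> ('a \<times> 'a) set" where
  "merges ps = foldr (\<lambda>p E. merge E (fst p) (snd p)) ps Id"

lemma merges_simps [simp]:
  "merges [] = Id" "merges (p # ps) = merge (merges ps) (fst p) (snd p)"
  by (simp_all add: merges_def)

lemma equiv_merges: "equiv UNIV (merges ps)"
  by (induction ps) (simp_all add: equiv_merge, simp add: equiv_def refl_Id sym_Id trans_Id)

lemma in_merges: "p \<in> set ps \<Longrightarrow> p \<in> merges ps"
proof (induction ps)
  case (Cons q ps)
  then show ?case
    using in_merge[OF equiv_merges, of "fst q" "snd q" ps] subset_merge by fastforce
qed simp

lemma tprod_merges: "(x, tprod ps x) \<in> merges ps"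
proof (induction ps)
  case (Cons p ps)
  note e = equivD[OF equiv_merges[of "p # ps"]]
  have "(x, tprod ps x) \<in> merges (p # ps)"
    using Cons subset_merge by fastforce
  moreover have "(y, transpose (fst p) (snd p) y) \<in> merges (p # ps)" for y
    using in_merges[of p "p # ps"] e(1) e(2)[of "fst p" "snd p"]
    by (simp add: transpose_def del: merges_simps)
  ultimately show ?case
    using e(3)[of x "tprod ps x"] by simp
qed simp

lemma num_classes_Id: "num_classes P Id = card P"
  unfolding num_classes_def by (rule card_image) (auto simp: inj_on_def)

lemma orbit_rel_id: "orbit_rel id = Id"
  using orbit_rel_least[of Id id] equivD(1)[OF equiv_orbit_rel]
  by (fastforce simp: equiv_def refl_Id sym_Id trans_Id)

lemma num_classes_merges_ge:
  assumes "finite P" "set ps \<subseteq> P \<times> P"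
  shows "card P \<le> num_classes P (merges ps) + length ps"
  using assms(2)
proof (induction ps)
  case (Cons p ps)
  then show ?case
    using num_classes_merge_le[OF assms(1) _ _ equiv_merges, of "fst p" "snd p" ps] by force
qed (simp add: num_classes_Id)

text \<open>The orbits of the product refine the classes of \<open>merges\<close>, and each
  transposition merges at most one pair of classes.\<close>

lemma num_classes_orbit_ge:
  assumes "finite P" "set ps \<subseteq> P \<times> P"
  shows "card P \<le> num_classes P (orbit_rel (tprod ps)) + length ps"
proof -
  have "num_classes P (merges ps) \<le> num_classes P (orbit_rel (tprod ps))"
    by (intro num_classes_mono assms equiv_merges equiv_orbit_rel orbit_rel_least tprod_merges)
  then show ?thesis
    using num_classes_merges_ge[OF assms] by simp
qed

text \<open>The Riemann--Hurwitz inequality for a product of transpositions.\<close>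

lemma num_classes_orbit_genus:
  assumes "finite P" "set ps \<subseteq> P \<times> P"
  shows "card P + num_classes P (orbit_rel (tprod ps)) \<le> 2 * num_classes P (merges ps) + length ps"
  using assms(2)
proof (induction ps)
  case (Cons p ps)
  obtain i j where p: "p = (i, j)" by fastforce
  then have ij: "i \<in> P" "j \<in> P" using Cons.prems by auto
  note IH = Cons.IH[OF order.trans[OF set_subset_Cons Cons.prems]]
  show ?case
  proof (cases "(i, j) \<in> merges ps")
    \<comment> \<open>The classes of \<open>merges\<close> do not change, so the right-hand side
      grows by one, and the orbit count grows by at most one.\<close>
    case True
    then show ?thesis
      using IH p num_classes_orbit_transpose_le[OF assms(1) ij, of "tprod ps"]
      by (simp add: merge_same equiv_merges del: comp_apply)
  next
    \<comment> \<open>The merge makes the right-hand side change by \<open>- 2 + 1\<close>. Since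
      orbits refine \<open>merges\<close>, the points \<open>i\<close> and \<open>j\<close> lie in
      different orbits, so the orbit count drops as well.\<close>
    case False
    have "orbit_rel (tprod ps) \<subseteq> merges ps"
      by (intro orbit_rel_least equiv_merges tprod_merges)
    then have "(i, j) \<notin> orbit_rel (tprod ps)" using False by blast
    then show ?thesis
      using IH p num_classes_orbit_transpose_join[OF assms(1) ij permutation_tprod, of ps]
        num_classes_merge[OF assms(1) ij equiv_merges False] by (simp del: comp_apply)
  qed
qed (simp add: num_classes_Id orbit_rel_id)

section \<open>Cycles of signed permutations\<close>

definition expand :: "(int \<times> int) list \<Rightarrow> (int \<times> int) list" where
  "expand ps = concat (map (\<lambda>p. [p, (- fst p, - snd p)]) ps)"

lemma expand_simps [simp]:
  "expand [] = []" "expand (p # ps) = p # (- fst p, - snd p) # expand ps"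
  by (simp_all add: expand_def)

lemma length_expand [simp]: "length (expand ps) = 2 * length ps"
  by (induction ps) auto

lemma rprod_expand: "set ps \<subseteq> roots n \<Longrightarrow> rprod ps = tprod (expand ps)"
proof (induction ps)
  case (Cons p ps)
  then have "(fst p, snd p) \<in> roots n" by auto
  from rootsD(3-5)[OF this] Cons show ?case
    by (simp add: sswap_eq_transpose o_assoc del: comp_apply)
qed simp

lemma expand_pts: "set ps \<subseteq> roots n \<Longrightarrow> set (expand ps) \<subseteq> pts n \<times> pts n"
  by (induction ps) (auto simp: roots_def)

text \<open>Each reflection counts as two transpositions of the \<open>2n\<close> points. Read
  backwards, this is a lower bound for the number of reflections in a factorization.\<close>

lemma num_classes_rprod_ge:
  assumes "set ps \<subseteq> roots n"
  shows "2 * n \<le> num_classes (pts n) (orbit_rel (rprod ps)) + 2 * length ps"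
  using num_classes_orbit_ge[OF finite_pts expand_pts[OF assms]]
  by (simp add: card_pts rprod_expand[OF assms])

text \<open>Hypothesis \<open>tr\<close> expresses transitivity of the reflections on the signed
  points by equivalence relations, so that it applies directly to \<open>merges\<close>. With a
  single class the genus inequality reads \<open>2n + orbits \<le> 2 + 2n\<close>.\<close>

lemma num_classes_rprod_le_2:
  assumes ps: "set ps \<subseteq> roots n" "length ps = n"
    and tr: "\<And>E x y. equiv UNIV E \<Longrightarrow> (\<And>a b z. (a, b) \<in> set ps \<Longrightarrow> (z, sswap a b z) \<in> E) \<Longrightarrow>
      x \<in> pts n \<Longrightarrow> y \<in> pts n \<Longrightarrow> (x, y) \<in> E"
  shows "num_classes (pts n) (orbit_rel (rprod ps)) \<le> 2"
proof -
  let ?E = "merges (expand ps)"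
  note e = equivD[OF equiv_merges[of "expand ps"]]
  have "(x, y) \<in> ?E" if xy: "x \<in> pts n" "y \<in> pts n" for x y
  proof (rule tr[OF equiv_merges _ xy])
    fix a b z assume ab: "(a, b) \<in> set ps"
    then have "(a, b) \<in> set (expand ps)" "(- a, - b) \<in> set (expand ps)"
      unfolding expand_def by (auto intro!: bexI[of _ "(a, b)"])
    then have "(a, b) \<in> ?E" "(- a, - b) \<in> ?E" by (auto intro: in_merges)
    then show "(z, sswap a b z) \<in> ?E"
      using e(1) e(2)[of a b] e(2)[of "- a" "- b"] by (simp add: sswap_def)
  qed
  then have const: "?E `` {x} = ?E `` {y}" if "x \<in> pts n" "y \<in> pts n" for x y
    using that by (intro equiv_class_eq[OF equiv_merges]) simp
  have "num_classes (pts n) ?E \<le> 1"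
  proof -
    have "\<forall>A \<in> (\<lambda>x. ?E `` {x}) ` pts n. \<forall>B \<in> (\<lambda>x. ?E `` {x}) ` pts n. A = B"
    proof (intro ballI)
      fix A B assume "A \<in> (\<lambda>x. ?E `` {x}) ` pts n" "B \<in> (\<lambda>x. ?E `` {x}) ` pts n"
      then show "A = B" by (elim imageE) (metis const)
    qed
    then show ?thesis
      unfolding num_classes_def One_nat_def
      by (subst card_le_Suc0_iff_eq) (simp_all only: finite_imageI finite_pts)
  qed
  then show ?thesis
    using num_classes_orbit_genus[OF finite_pts expand_pts[OF ps(1)]] ps
    by (simp add: card_pts rprod_expand[OF ps(1)])
qed

lemma num_classes_ge_3:
  assumes E: "equiv UNIV E" and P: "finite P" "x \<in> P" "y \<in> P" "z \<in> P"
    and n: "(x, y) \<notin> E" "(x, z) \<notin> E" "(y, z) \<notin> E"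
  shows "3 \<le> num_classes P E"
proof -
  have "card {E `` {x}, E `` {y}, E `` {z}} = 3"
    using n eq_equiv_class[OF _ E] by (auto simp: card_insert_if)
  moreover have "card {E `` {x}, E `` {y}, E `` {z}} \<le> card ((\<lambda>x. E `` {x}) ` P)"
    using P by (intro card_mono) auto
  ultimately show ?thesis by (simp add: num_classes_def)
qed

lemma orbit_rel_invariant:
  assumes "\<And>x. f x \<in> S \<longleftrightarrow> x \<in> S" and "(x, y) \<in> orbit_rel f"
  shows "x \<in> S \<longleftrightarrow> y \<in> S"
proof -
  have "orbit_rel f \<subseteq> {(x, y). x \<in> S \<longleftrightarrow> y \<in> S}"
    using assms(1)
    by (intro orbit_rel_least equivI) (auto simp: refl_on_def sym_def trans_def)
  then show ?thesis using assms(2) by auto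
qed

section \<open>Signed cycles as lists of letters\<close>

definition chain :: "'a list \<Rightarrow> ('a \<times> 'a) list" where
  "chain xs = zip xs (tl xs)"

lemma chain_simps [simp]:
  "chain [] = []" "chain [x] = []" "chain (x # y # zs) = (x, y) # chain (y # zs)"
  by (simp_all add: chain_def)

lemma length_chain [simp]: "length (chain xs) = length xs - 1"
  by (simp add: chain_def)

text \<open>The list holds one representative of each pair \<open>x\<close>, \<open>- x\<close>. For
  \<open>e = 1\<close> the cycle is positive, with \<open>xs\<close> and its negatives as separate
  orbits; for \<open>e = - 1\<close> the walk passes from the last letter to minus the first, giving
  one orbit of twice the length.\<close>

definition signed_cycle :: "(int \<Rightarrow> int) \<Rightarrow> int list \<Rightarrow> int \<Rightarrow> bool" where
  "signed_cycle f xs e \<longleftrightarrow> xs \<noteq> [] \<and> distinct (map abs xs) \<and>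
     (\<forall>i. Suc i < length xs \<longrightarrow> f (xs ! i) = xs ! Suc i) \<and> f (last xs) = e * hd xs"

definition supp :: "int list \<Rightarrow> int set" where
  "supp xs = {z. \<bar>z\<bar> \<in> abs ` set xs}"

lemma supp_simps [simp]:
  "supp [] = {}" "supp (x # xs) = {x, - x} \<union> supp xs" "supp (xs @ ys) = supp xs \<union> supp ys"
  by (auto simp: supp_def)

lemma supp_uminus [simp]: "- z \<in> supp xs \<longleftrightarrow> z \<in> supp xs"
  by (simp add: supp_def)

lemma supp_iff: "z \<in> supp xs \<longleftrightarrow> (\<exists>x \<in> set xs. z = x \<or> z = - x)"
  by (auto simp: supp_def abs_eq_iff)

lemma finite_supp [simp]: "finite (supp xs)"
  by (induction xs) auto

lemma card_supp: "distinct (map abs xs) \<Longrightarrow> 0 \<notin> set xs \<Longrightarrow> card (supp xs) = 2 * length xs"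
proof (induction xs)
  case (Cons x xs)
  then have "x \<notin> supp xs" "- x \<notin> supp xs" by (auto simp: supp_def)
  then show ?case using Cons by (simp add: card_insert_if)
qed simp

lemma set_chain_roots:
  assumes "distinct (map abs xs)" "set xs \<subseteq> pts n"
  shows "set (chain xs) \<subseteq> roots n"
  using assms
proof (induction xs rule: induct_list012)
  case (3 x y zs)
  then show ?case by (auto simp: roots_def)
qed auto

lemma rprod_chain_fix: "z \<notin> supp xs \<Longrightarrow> rprod (chain xs) z = z"
  by (induction xs rule: induct_list012) (auto simp: sswap_def)

text \<open>The cycle on \<open>y # zs\<close> fixes \<open>x\<close> and closes up at
  \<open>y\<close>. The extra factor \<open>sswap x y\<close> in front turns these two values into
  \<open>y\<close> and \<open>x\<close>, which inserts \<open>x\<close> before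
  \<open>y\<close>.\<close>

lemma signed_cycle_chain:
  assumes "xs \<noteq> []" "distinct (map abs xs)" "0 \<notin> set xs"
  shows "signed_cycle (rprod (chain xs)) xs 1"
  using assms
proof (induction xs rule: induct_list012)
  case (3 x y zs)
  let ?c = "rprod (chain (y # zs))"
  have IH: "signed_cycle ?c (y # zs) 1" using 3 by simp
  have x: "x \<noteq> 0" "y \<noteq> 0" "\<bar>x\<bar> \<noteq> \<bar>y\<bar>" using 3 by auto
  have "x \<notin> supp (y # zs)" using 3(4) by (auto simp: supp_def)
  then have cx: "?c x = x" by (rule rprod_chain_fix)
  show ?case
    unfolding signed_cycle_def
  proof (intro conjI allI impI)
    fix i assume i: "Suc i < length (x # y # zs)"
    show "rprod (chain (x # y # zs)) ((x # y # zs) ! i) = (x # y # zs) ! Suc i"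
    proof (cases i)
      case 0
      then show ?thesis using cx x by (simp add: sswap_def)
    next
      case (Suc j)
      then have z: "?c ((y # zs) ! j) = zs ! j" "zs ! j \<in> set zs"
        using IH i by (auto simp: signed_cycle_def)
      have "\<bar>zs ! j\<bar> \<in> abs ` set zs" using z(2) by (rule imageI)
      then have "\<bar>zs ! j\<bar> \<noteq> \<bar>x\<bar>" "\<bar>zs ! j\<bar> \<noteq> \<bar>y\<bar>" using 3(4) by auto
      then have "sswap x y (zs ! j) = zs ! j" by (auto simp: sswap_def)
      then show ?thesis using z Suc by simp
    qed
  next
    have "?c (last (y # zs)) = y" using IH by (simp add: signed_cycle_def)
    then show "rprod (chain (x # y # zs)) (last (x # y # zs)) = 1 * hd (x # y # zs)"
      using x by (simp add: sswap_def)
  qed (use 3 in auto)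
qed (auto simp: signed_cycle_def)

lemma in_set_cases_last:
  assumes "x \<in> set xs"
  obtains (nth) i where "Suc i < length xs" "x = xs ! i" | (last) "x = last xs"
proof -
  from assms obtain i where i: "i < length xs" "x = xs ! i" by (auto simp: in_set_conv_nth)
  show thesis
  proof (cases "Suc i < length xs")
    case False
    then have "i = length xs - 1" "xs \<noteq> []" using i by auto
    then show thesis using last i by (simp add: last_conv_nth)
  qed (use nth i in blast)
qed

lemma signed_cycle_agree:
  assumes "signed_cycle f xs e" "signed_cycle g xs e" "signed_perm n f" "signed_perm n g" "z \<in> supp xs"
  shows "f z = g z"
proof -
  have *: "f x = g x" if "x \<in> set xs" for x
    using that by (cases rule: in_set_cases_last) (use assms(1,2) in \<open>simp_all add: signed_cycle_def\<close>)
  from assms(5) obtain x where "x \<in> set xs" "z = x \<or> z = - x" by (auto simp: supp_iff)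
  then show ?thesis
    using * assms(3,4) by (auto simp: signed_perm_odd)
qed

lemma signed_cycle_supp:
  assumes f: "signed_perm n f" and c: "signed_cycle f xs e" and e: "e = 1 \<or> e = - 1"
  shows "f z \<in> supp xs \<longleftrightarrow> z \<in> supp xs"
proof -
  have 1: "f x \<in> supp xs" if "x \<in> set xs" for x
    using that
  proof (cases rule: in_set_cases_last)
    case (nth i)
    then show ?thesis using c by (auto simp: signed_cycle_def supp_iff)
  next
    case last
    then have "f x = e * hd xs" "hd xs \<in> set xs" using c by (simp_all add: signed_cycle_def)
    then show ?thesis using e unfolding supp_iff by auto
  qed
  have "f z \<in> supp xs" if "z \<in> supp xs" for z
  proof -
    from that obtain x where "x \<in> set xs" "z = x \<or> z = - x" unfolding supp_iff by blast
    then show ?thesis using 1 signed_perm_odd[OF f, of x] by auto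
  qed
  then have "f ` supp xs \<subseteq> supp xs" by blast
  moreover have "inj_on f (supp xs)" using signed_perm_inj[OF f] by (auto simp: inj_on_def)
  ultimately have "f ` supp xs = supp xs" by (intro endo_inj_surj) auto
  then show ?thesis using signed_perm_inj[OF f] by (metis image_iff)
qed

lemma ex_signed_cycle:
  assumes f: "signed_perm n f" and x: "x \<in> pts n"
  obtains xs e where "signed_cycle f xs e" "e = 1 \<or> e = - 1" "hd xs = x" "set xs \<subseteq> pts n"
proof -
  \<comment> \<open>The walk stops when the absolute value returns, not the point; it is then at
    \<open>x\<close> or \<open>- x\<close>, which decides the sign \<open>e\<close>.\<close>
  define Q where "Q k \<longleftrightarrow> 0 < k \<and> \<bar>(f ^^ k) x\<bar> = \<bar>x\<bar>" for k
  define k where "k = (LEAST k. Q k)"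
  have "Q (least_power f x)"
    using least_power_of_permutation[OF signed_perm_permutation[OF f], of x] by (simp add: Q_def)
  then have k: "Q k" unfolding k_def by (rule LeastI)
  have min: "\<not> Q l" if "l < k" for l using that not_less_Least unfolding k_def by blast
  define xs where "xs = map (\<lambda>i. (f ^^ i) x) [0..<k]"
  define e :: int where "e = (if (f ^^ k) x = x then 1 else - 1)"
  have k0: "0 < k" using k by (simp add: Q_def)
  have pw: "\<bar>(f ^^ i) u\<bar> = \<bar>(f ^^ i) v\<bar> \<longleftrightarrow> \<bar>u\<bar> = \<bar>v\<bar>" for i u v
    by (induction i) (auto simp: signed_perm_abs[OF f])
  have ne: "\<bar>(f ^^ i) x\<bar> \<noteq> \<bar>(f ^^ j) x\<bar>" if "i < j" "j < k" for i j
  proof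
    assume a: "\<bar>(f ^^ i) x\<bar> = \<bar>(f ^^ j) x\<bar>"
    have "(f ^^ j) x = (f ^^ i) ((f ^^ (j - i)) x)"
      using that funpow_add[of i "j - i" f] by simp
    then have "Q (j - i)" using a pw that unfolding Q_def by simp
    then show False using min[of "j - i"] that by simp
  qed
  have "signed_cycle f xs e"
    unfolding signed_cycle_def
  proof (intro conjI allI impI)
    show "distinct (map abs xs)"
      unfolding xs_def distinct_conv_nth using ne by (auto, metis linorder_neqE_nat)
    show "f (last xs) = e * hd xs"
    proof -
      have "f (last xs) = (f ^^ k) x"
        using k0 by (cases k) (simp_all add: xs_def last_map)
      moreover have "hd xs = x" using k0 by (simp add: xs_def hd_map)
      moreover have "\<bar>(f ^^ k) x\<bar> = \<bar>x\<bar>" using k by (simp add: Q_def)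
      ultimately show ?thesis by (auto simp: e_def)
    qed
  qed (use k0 in \<open>auto simp: xs_def\<close>)
  moreover have "hd xs = x" using k0 by (simp add: xs_def hd_map)
  moreover have "(f ^^ i) x \<in> pts n" for i
    by (induction i) (auto simp: x signed_perm_pts[OF f])
  then have "set xs \<subseteq> pts n" by (auto simp: xs_def)
  ultimately show ?thesis using that[of xs e] by (simp add: e_def)
qed

lemma supp_subset_pts: "set xs \<subseteq> pts n \<Longrightarrow> supp xs \<subseteq> pts n"
  unfolding supp_iff subset_iff by auto

text \<open>For a positive cycle the set of listed letters is itself invariant under
  \<open>f\<close>, and distinct absolute values keep \<open>- hd xs\<close> out of it.\<close>

lemma signed_cycle_positive_orbit:
  assumes f: "signed_perm n f" and c: "signed_cycle f xs 1" and 0: "0 \<notin> set xs"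
  shows "(hd xs, - hd xs) \<notin> orbit_rel f"
proof
  assume o: "(hd xs, - hd xs) \<in> orbit_rel f"
  have d: "xs \<noteq> []" "distinct (map abs xs)" using c by (auto simp: signed_cycle_def)
  have "f x \<in> set xs" if "x \<in> set xs" for x
    using that by (cases rule: in_set_cases_last) (use c in \<open>auto simp: signed_cycle_def\<close>)
  moreover have "inj_on f (set xs)" using signed_perm_inj[OF f] by (auto simp: inj_on_def)
  ultimately have "f ` set xs = set xs" by (intro endo_inj_surj) auto
  then have "f z \<in> set xs \<longleftrightarrow> z \<in> set xs" for z using signed_perm_inj[OF f] by (metis image_iff)
  from orbit_rel_invariant[OF this o] have m: "- hd xs \<in> set xs" using d by simp
  have "inj_on abs (set xs)" using d by (simp add: distinct_map)
  from inj_onD[OF this _ m hd_in_set[OF d(1)]] have "- hd xs = hd xs" by simp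
  then show False using 0 d by (metis equal_neg_zero hd_in_set)
qed


lemma two_negative_cycles:
  assumes f: "signed_perm n f" and n: "n \<ge> 1" and s: "sign f = 1"
    and le2: "num_classes (pts n) (orbit_rel f) \<le> 2"
    and red: "\<And>ps. set ps \<subseteq> roots n \<Longrightarrow> length ps = n - 1 \<Longrightarrow> f \<noteq> rprod ps"
  obtains xs ys where "signed_cycle f xs (- 1)" "signed_cycle f ys (- 1)"
    "distinct (map abs (xs @ ys))" "supp (xs @ ys) = pts n"
proof -
  have three: False
    if "x \<in> pts n" "y \<in> pts n" "z \<in> pts n" "(x, y) \<notin> orbit_rel f" "(x, z) \<notin> orbit_rel f" "(y, z) \<notin> orbit_rel f"
    for x y z
    using num_classes_ge_3[OF equiv_orbit_rel finite_pts that] le2 by simp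
  have full: "signed_perm n (rprod (chain xs))" "sign (rprod (chain xs)) = 1" "set (chain xs) \<subseteq> roots n"
    if "signed_cycle f xs e" "set xs \<subseteq> pts n" for xs e
    using that signed_perm_rprod[OF set_chain_roots] sign_rprod[OF set_chain_roots] set_chain_roots
    by (auto simp: signed_cycle_def)
  have sep: "(u, v) \<notin> orbit_rel f"
    if "signed_cycle f xs e" "e = 1 \<or> e = - 1" "u \<in> supp xs" "v \<notin> supp xs" for u v xs e
    using orbit_rel_invariant[OF signed_cycle_supp[OF f that(1,2)]] that(3,4) by blast
  have hd: "hd xs \<in> supp xs" "hd xs \<in> set xs" if "signed_cycle f xs e" for xs e
    using that by (auto simp: signed_cycle_def supp_iff)
  have neg: "e = - 1" if c: "signed_cycle f xs e" "e = 1 \<or> e = - 1" "set xs \<subseteq> pts n" for xs e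
  proof (rule ccontr)
    assume "e \<noteq> - 1"
    then have e: "e = 1" using c by simp
    have 0: "0 \<notin> set xs" using c(3) by auto
    have d: "xs \<noteq> []" "distinct (map abs xs)" using c by (auto simp: signed_cycle_def)
    show False
    proof (cases "supp xs = pts n")
      case True
      then have "length xs = n" using card_supp[OF d(2) 0] by (simp add: card_pts)
      \<comment> \<open>A positive cycle through all letters is the product of its
        \<open>n - 1\<close> chain reflections, contrary to \<open>red\<close>.\<close>
      moreover have "f = rprod (chain xs)"
      proof
        fix z
        have "f z = rprod (chain xs) z" if "z \<in> supp xs"
          using signed_cycle_agree[OF _ signed_cycle_chain[OF d 0] f full(1)[OF c(1,3)] that] c e by simp
        then show "f z = rprod (chain xs) z"
          using True rprod_chain_fix signed_perm_fix[OF f] by metis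
      qed
      ultimately show False using red[OF full(3)[OF c(1,3)]] by simp
    next
      case False
      \<comment> \<open>A positive cycle already uses two orbits, those of \<open>hd xs\<close> and
        \<open>- hd xs\<close>; the point \<open>y\<close> would start a third.\<close>
      then obtain y where y: "y \<in> pts n" "y \<notin> supp xs" using supp_subset_pts[OF c(3)] by blast
      show False
        using three[of "hd xs" "- hd xs" y] sep[OF c(1,2)] hd[OF c(1)] y c(3)
          signed_cycle_positive_orbit[OF f c(1)[unfolded e] 0] by auto
    qed
  qed
  have "1 \<in> pts n" using n by (simp add: pts_def)
  from ex_signed_cycle[OF f this] obtain xs e
    where xs: "signed_cycle f xs e" "e = 1 \<or> e = - 1" "set xs \<subseteq> pts n" by metis
  have e: "e = - 1" by (rule neg[OF xs])
  have dx: "xs \<noteq> []" "distinct (map abs xs)" using xs by (auto simp: signed_cycle_def)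
  have 0: "0 \<notin> set xs" using xs(3) by auto
  have "supp xs \<noteq> pts n"
  proof
    assume eq: "supp xs = pts n"
    let ?a = "last xs" and ?c = "rprod (chain xs)"
    have a: "?a \<noteq> 0" "?a \<in> set xs" using dx 0 by (metis last_in_set)+
    have cyc: "signed_cycle ?c xs 1" by (rule signed_cycle_chain[OF dx 0])
    have odd: "?c (- z) = - ?c z" for z
      using signed_perm_odd[OF full(1)[OF xs(1,3)]] by simp
    have inj: "\<bar>xs ! i\<bar> \<noteq> \<bar>?a\<bar>" if "Suc i < length xs" for i
      using dx that by (auto simp: last_conv_nth distinct_conv_nth)
    \<comment> \<open>A negative cycle is the positive one preceded by the sign change of its last
      letter. On the points this sign change is a single transposition, so one negative cycle on all
      letters would be odd.\<close>
    have "f = ?c \<circ> transpose ?a (- ?a)"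
    proof
      fix z
      have "signed_perm n (transpose ?a (- ?a))"
        using a xs(3) by (auto simp: signed_perm_def transpose_def intro!: permutes_swap_id)
      then have g: "signed_perm n (?c \<circ> transpose ?a (- ?a))"
        by (intro signed_perm_comp full(1)[OF xs(1,3)])
      have "signed_cycle (?c \<circ> transpose ?a (- ?a)) xs (- 1)"
        unfolding signed_cycle_def
      proof (intro conjI allI impI)
        fix i assume i: "Suc i < length xs"
        have "transpose ?a (- ?a) (xs ! i) = xs ! i"
          using inj[OF i] by (auto simp: transpose_def)
        then show "(?c \<circ> transpose ?a (- ?a)) (xs ! i) = xs ! Suc i"
          using cyc i by (simp add: signed_cycle_def)
      next
        show "(?c \<circ> transpose ?a (- ?a)) (last xs) = - 1 * hd xs"
          using cyc odd by (simp add: signed_cycle_def)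
      qed (use dx in auto)
      from signed_cycle_agree[OF xs(1)[unfolded e] this f g, of z]
      show "f z = (?c \<circ> transpose ?a (- ?a)) z"
        using eq signed_perm_fix[OF f, of z] signed_perm_fix[OF g, of z] by metis
    qed
    then have "sign f = sign ?c * sign (transpose ?a (- ?a))"
      using full(1)[OF xs(1,3)] by (simp add: sign_compose signed_perm_permutation permutation_swap_id del: comp_apply)
    then show False using s full(2)[OF xs(1,3)] a by (simp add: sign_swap_id)
  qed
  then obtain y where y: "y \<in> pts n" "y \<notin> supp xs" using supp_subset_pts[OF xs(3)] by blast
  from ex_signed_cycle[OF f this(1)] obtain ys e'
    where ys: "signed_cycle f ys e'" "e' = 1 \<or> e' = - 1" "hd ys = y" "set ys \<subseteq> pts n" by metis
  have e': "e' = - 1" by (rule neg[OF ys(1,2,4)])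
  have dy: "ys \<noteq> []" "distinct (map abs ys)" using ys by (auto simp: signed_cycle_def)
  have nth: "ys ! i \<notin> supp xs" if "i < length ys" for i
    using that
  proof (induction i)
    case 0
    then show ?case using y ys dy by (simp add: hd_conv_nth)
  next
    case (Suc i)
    then have "ys ! Suc i = f (ys ! i)" using ys by (simp add: signed_cycle_def)
    then show ?case using Suc signed_cycle_supp[OF f xs(1,2)] by simp
  qed
  then have "set ys \<inter> supp xs = {}" by (auto simp: in_set_conv_nth)
  then have "distinct (map abs (xs @ ys))"
    using dx dy unfolding supp_def by (simp add: disjoint_iff) blast
  moreover have "supp (xs @ ys) = pts n"
  proof (rule ccontr)
    assume "supp (xs @ ys) \<noteq> pts n"
    moreover have "supp (xs @ ys) \<subseteq> pts n" using xs(3) ys(4) supp_subset_pts[of "xs @ ys"] by simp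
    ultimately obtain z where z: "z \<in> pts n" "z \<notin> supp xs" "z \<notin> supp ys" by auto
    show False
      using three[of "hd xs" y z] sep[OF xs(1,2)] sep[OF ys(1,2)] hd[OF xs(1)] hd[OF ys(1)] y z xs(3) ys(3)
      by auto
  qed
  ultimately show ?thesis using that xs(1) ys(1) e e' by blast
qed

section \<open>The Coxeter group of type D as a group of signed permutations\<close>

text \<open>Node \<open>k < n - 1\<close> carries \<open>e_(n-k) - e_(n-k-1)\<close>, and node
  \<open>n - 1\<close> carries \<open>e_2 + e_1\<close>, written as the pair
  \<open>(2, - 1)\<close>. Nodes \<open>n - 2\<close> and \<open>n - 1\<close> form the fork
  attached to \<open>e_3 - e_2\<close> at node \<open>n - 3\<close>.\<close>

definition root_fst :: "nat \<Rightarrow> nat \<Rightarrow> int" where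
  "root_fst n k = (if k = n - 1 then 2 else int n - int k)"

definition root_snd :: "nat \<Rightarrow> nat \<Rightarrow> int" where
  "root_snd n k = (if k = n - 1 then - 1 else int n - int k - 1)"

definition simple_perm :: "nat \<Rightarrow> nat \<Rightarrow> int \<Rightarrow> int" where
  "simple_perm n k = sswap (root_fst n k) (root_snd n k)"

definition act :: "nat \<Rightarrow> nat list \<Rightarrow> int \<Rightarrow> int" where
  "act n u = foldr (\<lambda>k f. simple_perm n k \<circ> f) u id"

lemma act_simps [simp]: "act n [] = id" "act n (k # u) = simple_perm n k \<circ> act n u"
  by (simp_all add: act_def)

lemma act_append: "act n (u @ v) = act n u \<circ> act n v"
  by (induction u) auto

lemma simple_root: "n \<ge> 4 \<Longrightarrow> k < n \<Longrightarrow> (root_fst n k, root_snd n k) \<in> roots n"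
  by (auto simp: roots_def pts_def root_fst_def root_snd_def)

lemma simple_root_gt: "n \<ge> 4 \<Longrightarrow> k < n \<Longrightarrow> root_fst n k > root_snd n k"
  by (auto simp: root_fst_def root_snd_def)

lemma signed_perm_simple: "n \<ge> 4 \<Longrightarrow> k < n \<Longrightarrow> signed_perm n (simple_perm n k)"
  unfolding simple_perm_def by (intro signed_perm_sswap simple_root)

lemma simple_perm_root:
  assumes "n \<ge> 4" "k < n"
  shows "simple_perm n k (root_fst n k) = root_snd n k" "simple_perm n k (root_snd n k) = root_fst n k"
  using rootsD[OF simple_root[OF assms]] by (auto simp: simple_perm_def sswap_def)

lemma type_D_cases: "type_D n i j = 1 \<and> i = j \<or> i \<noteq> j \<and> type_D n i j = 2 \<or> i \<noteq> j \<and> type_D n i j = 3"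
  by (auto simp: type_D_def)

text \<open>Neighbouring simple roots are written so that the second entry of one is the first entry
  of the other, the shape required by \<open>sswap_braid\<close>.\<close>

lemma type_D_adjacent:
  assumes "n \<ge> 4" "i < n" "j < n" "type_D n i j = 3"
  shows "root_snd n i = root_fst n j \<and> \<bar>root_fst n i\<bar> \<noteq> \<bar>root_snd n j\<bar> \<or>
    root_snd n j = root_fst n i \<and> \<bar>root_fst n j\<bar> \<noteq> \<bar>root_snd n i\<bar>"
proof -
  have "{i, j} \<in> type_D_edges n"
    using assms(4) by (auto simp: type_D_def split: if_splits)
  then consider k where "k + 2 < n" "i = k \<and> j = k + 1 \<or> i = k + 1 \<and> j = k"
    | "i = n - 3 \<and> j = n - 1 \<or> i = n - 1 \<and> j = n - 3"
    unfolding type_D_edges_def by (auto simp: doubleton_eq_iff)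
  then show ?thesis
    by cases (use assms(1) in \<open>auto simp: root_fst_def root_snd_def of_nat_diff\<close>)
qed

text \<open>Nodes that are not joined usually have roots without a common letter. The exception is
  the fork: \<open>e_2 - e_1\<close> and \<open>e_2 + e_1\<close> share both letters but are
  orthogonal, and the reflection in one turns the pair \<open>(a, b)\<close> of the other into
  \<open>(- b, - a)\<close>, another name for the same root.\<close>

lemma type_D_nonadjacent:
  assumes "n \<ge> 4" "i < n" "j < n" "i \<noteq> j" "type_D n i j = 2"
  shows "simple_perm n j (root_fst n i) = root_fst n i \<and> simple_perm n j (root_snd n i) = root_snd n i \<or>
    simple_perm n j (root_fst n i) = - root_snd n i \<and> simple_perm n j (root_snd n i) = - root_fst n i"
proof -
  have ne: "{i, j} \<notin> type_D_edges n"
    using assms(4,5) by (auto simp: type_D_def)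
  have e1: "j \<noteq> i + 1" if "i + 2 < n"
  proof
    assume "j = i + 1"
    then have "{i, j} \<in> {{k, k + 1} | k. k + 2 < n}" using that by blast
    then show False using ne by (simp add: type_D_edges_def)
  qed
  have e2: "i \<noteq> j + 1" if "j + 2 < n"
  proof
    assume "i = j + 1"
    then have "{i, j} \<in> {{k, k + 1} | k. k + 2 < n}" using that by (auto simp: insert_commute)
    then show False using ne by (simp add: type_D_edges_def)
  qed
  have e3: "\<not> (i = n - 3 \<and> j = n - 1)" "\<not> (j = n - 3 \<and> i = n - 1)"
    using ne by (auto simp: type_D_edges_def insert_commute)
  consider "i = n - 1" "j = n - 2" | "i = n - 1" "j + 3 < n" | "j = n - 1" "i = n - 2"
    | "j = n - 1" "i + 3 < n" | "i + 1 < j" "j + 1 < n" | "j + 1 < i" "i + 1 < n"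
  proof (cases "i = n - 1 \<or> j = n - 1")
    case True
    have "k = n - 2 \<or> k + 3 < n" if "k < n" "k \<noteq> n - 1" "k \<noteq> n - 3" for k
      using that by linarith
    then show thesis using True assms(2-4) e3 that(1-4) by metis
  next
    case False
    then have "i + 1 < n" "j + 1 < n" using assms(2,3) by auto
    moreover from this have "i + 1 < j \<or> j + 1 < i" using assms(4) e1 e2 by (cases "i < j") auto
    ultimately show thesis using that by blast
  qed
  then consider "{i, j} = {n - 1, n - 2}" | "\<forall>a \<in> {root_fst n i, root_snd n i}. \<forall>b \<in> {root_fst n j, root_snd n j}. \<bar>a\<bar> \<noteq> \<bar>b\<bar>"
  proof cases
    case 5
    then have "i \<noteq> n - 1" "j \<noteq> n - 1" by auto
    then show ?thesis using 5 that(2) by (simp add: root_fst_def root_snd_def)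
  next
    case 6
    then have "i \<noteq> n - 1" "j \<noteq> n - 1" by auto
    then show ?thesis using 6 that(2) by (simp add: root_fst_def root_snd_def)
  qed (use assms(1) that in \<open>simp_all add: root_fst_def root_snd_def insert_commute\<close>)
  then show ?thesis
  proof cases
    case 1
    have "sswap 2 1 2 = 1" "sswap 2 1 (- 1) = - 2" "sswap 2 (- 1) 2 = - 1" "sswap 2 (- 1) 1 = - 2"
      by (simp_all add: sswap_def)
    moreover have "int n - int (n - 2) = 2" "n - 2 \<noteq> n - 1" using assms(1) by auto
    ultimately show ?thesis
      using 1 assms(4) by (auto simp: doubleton_eq_iff simple_perm_def root_fst_def root_snd_def)
  next
    case 2
    then show ?thesis by (simp add: simple_perm_def sswap_other)
  qed
qed

lemma simple_perm_involution: "n \<ge> 4 \<Longrightarrow> k < n \<Longrightarrow> simple_perm n k (simple_perm n k x) = x"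
  using rootsD[OF simple_root, of n k] by (simp add: simple_perm_def)

lemma simple_perm_commute:
  assumes "n \<ge> 4" "i < n" "j < n" "i \<noteq> j" "type_D n i j = 2"
  shows "simple_perm n j (simple_perm n i x) = simple_perm n i (simple_perm n j x)"
proof -
  note r = rootsD[OF simple_root[OF assms(1,2)]]
  have "simple_perm n j \<circ> simple_perm n i =
      sswap (simple_perm n j (root_fst n i)) (simple_perm n j (root_snd n i)) \<circ> simple_perm n j"
    using signed_perm_sswap_conj[OF signed_perm_simple[OF assms(1,3)]]
    by (simp only: simple_perm_def[of n i])
  also have "\<dots> = simple_perm n i \<circ> simple_perm n j"
    using type_D_nonadjacent[OF assms] r sswap_uminus[of "root_snd n i" "root_fst n i"]
      sswap_commute[of "root_snd n i" "root_fst n i"]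
    by (auto simp: simple_perm_def)
  finally show ?thesis by (simp add: fun_eq_iff)
qed

lemma sswap_braid:
  assumes "a \<noteq> 0" "b \<noteq> 0" "c \<noteq> 0" "\<bar>a\<bar> \<noteq> \<bar>b\<bar>" "\<bar>b\<bar> \<noteq> \<bar>c\<bar>" "\<bar>a\<bar> \<noteq> \<bar>c\<bar>"
  shows "sswap a b (sswap b c (sswap a b x)) = sswap b c (sswap a b (sswap b c x))"
  using assms unfolding sswap_def by (smt (verit))

lemma simple_perm_braid:
  assumes "n \<ge> 4" "i < n" "j < n" "type_D n i j = 3"
  shows "simple_perm n i (simple_perm n j (simple_perm n i x)) =
    simple_perm n j (simple_perm n i (simple_perm n j x))"
proof -
  note r = rootsD[OF simple_root[OF assms(1,2)]] rootsD[OF simple_root[OF assms(1,3)]]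
  from type_D_adjacent[OF assms] show ?thesis
  proof
    assume "root_snd n i = root_fst n j \<and> \<bar>root_fst n i\<bar> \<noteq> \<bar>root_snd n j\<bar>"
    with sswap_braid[of "root_fst n i" "root_snd n i" "root_snd n j" x] r show ?thesis
      by (simp add: simple_perm_def)
  next
    assume "root_snd n j = root_fst n i \<and> \<bar>root_fst n j\<bar> \<noteq> \<bar>root_snd n i\<bar>"
    with sswap_braid[of "root_fst n j" "root_snd n j" "root_snd n i" x] r show ?thesis
      by (simp add: simple_perm_def)
  qed
qed

lemma act_relator:
  assumes "n \<ge> 4" "i < n" "j < n"
  shows "act n (concat (replicate (type_D n i j) [i, j])) = id"
proof -
  note s = simple_perm_involution[OF assms(1,2)] simple_perm_involution[OF assms(1,3)]
  from type_D_cases[of n i j] consider "i = j" "type_D n i j = 1" | "i \<noteq> j" "type_D n i j = 2"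
    | "type_D n i j = 3" by blast
  then show ?thesis
  proof cases
    case 1
    then show ?thesis using s by (auto simp: fun_eq_iff)
  next
    case 2
    then show ?thesis using s simple_perm_commute[OF assms 2]
      by (auto simp: fun_eq_iff numeral_2_eq_2)
  next
    case 3
    then show ?thesis using s simple_perm_braid[OF assms 3]
      by (auto simp: fun_eq_iff numeral_3_eq_3)
  qed
qed

lemma coxeter_word_eq_act:
  assumes "n \<ge> 4" "coxeter_word_eq {..<n} (type_D n) u v"
  shows "act n u = act n v"
  using assms(2)
proof (induction rule: coxeter_word_eq.induct)
  case (relator i j)
  then show ?case using act_relator[OF assms(1), of i j] by simp
qed (simp_all add: act_append)

lemma coxeter_word_eq_parity:
  "coxeter_word_eq I M u v \<Longrightarrow> even (length u) \<longleftrightarrow> even (length v)"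
proof (induction rule: coxeter_word_eq.induct)
  case (relator i j)
  have "length (concat (replicate k [i, j])) = 2 * k" for k by (induction k) auto
  then show ?case by simp
qed auto

locale type_D_system = coxeter_system G "{..<n}" "type_D n" s
  for G :: "('a, 'b) monoid_scheme" (structure) and n :: nat and s :: "nat \<Rightarrow> 'a" +
  assumes n4: "n \<ge> 4"
begin

abbreviation ev :: "nat list \<Rightarrow> 'a" where "ev u \<equiv> list_mult G (map s u)"

text \<open>The presentation makes the value independent of the chosen word; this is
  \<open>phi_ev\<close>.\<close>

definition phi :: "'a \<Rightarrow> int \<Rightarrow> int" where
  "phi g = act n (SOME u. u \<in> lists {..<n} \<and> ev u = g)"

lemma map_s_closed: "u \<in> lists {..<n} \<Longrightarrow> map s u \<in> lists (carrier G)"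
  by (auto simp: simple_closed)

lemma ev_closed [simp]: "u \<in> lists {..<n} \<Longrightarrow> ev u \<in> carrier G"
  by (intro list_mult_closed map_s_closed)

lemma ev_append: "u \<in> lists {..<n} \<Longrightarrow> v \<in> lists {..<n} \<Longrightarrow> ev (u @ v) = ev u \<otimes> ev v"
  unfolding map_append by (intro list_mult_append map_s_closed)

lemma ex_word: "g \<in> carrier G \<Longrightarrow> \<exists>u \<in> lists {..<n}. ev u = g"
proof -
  assume "g \<in> carrier G"
  moreover have "inv t \<in> s ` {..<n}" if "t \<in> s ` {..<n}" for t
    using that simple_square simple_closed by (auto intro!: inv_equality imageI simp: inv_equality)
  ultimately obtain ts where ts: "ts \<in> lists (s ` {..<n})" "list_mult G ts = g"
    using generate_list_mult[of "s ` {..<n}" g] simple_closed simple_generate by blast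
  then obtain u where "u \<in> lists {..<n}" "ts = map s u"
    by (metis image_eqI lists_image imageE)
  then show ?thesis using ts by blast
qed

lemma phi_ev: "u \<in> lists {..<n} \<Longrightarrow> phi (ev u) = act n u"
proof -
  assume u: "u \<in> lists {..<n}"
  define v where "v = (SOME v. v \<in> lists {..<n} \<and> ev v = ev u)"
  have v: "v \<in> lists {..<n} \<and> ev v = ev u"
    unfolding v_def by (rule someI[of _ u]) (use u in simp)
  then have "coxeter_word_eq {..<n} (type_D n) v u" using presentation u by blast
  then show ?thesis
    using coxeter_word_eq_act[OF n4] by (simp add: phi_def v_def)
qed

lemma phi_mult: "g \<in> carrier G \<Longrightarrow> h \<in> carrier G \<Longrightarrow> phi (g \<otimes> h) = phi g \<circ> phi h"
proof -
  assume "g \<in> carrier G" "h \<in> carrier G"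
  then obtain u v where uv: "u \<in> lists {..<n}" "v \<in> lists {..<n}" "ev u = g" "ev v = h"
    using ex_word by metis
  then have "g \<otimes> h = ev (u @ v)" by (simp only: ev_append)
  moreover have "phi (ev (u @ v)) = act n (u @ v)" using uv by (intro phi_ev) simp
  ultimately show ?thesis using phi_ev[OF uv(1)] phi_ev[OF uv(2)] uv(3,4) by (simp add: act_append)
qed

lemma phi_one: "phi \<one> = id"
  using phi_ev[of "[]"] by simp

lemma phi_simple: "k < n \<Longrightarrow> phi (s k) = simple_perm n k"
  using phi_ev[of "[k]"] simple_closed[of k] by simp

lemma signed_perm_phi: "g \<in> carrier G \<Longrightarrow> signed_perm n (phi g)"
proof -
  assume "g \<in> carrier G"
  then obtain u where u: "u \<in> lists {..<n}" "ev u = g" using ex_word by blast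
  have "signed_perm n (act n u)" using u(1)
  proof (induction u)
    case (Cons k u)
    then show ?case
      using signed_perm_comp[OF signed_perm_simple[OF n4]] by (simp del: comp_apply)
  qed (simp only: act_simps signed_perm_id)
  then show ?thesis using phi_ev[OF u(1)] u(2) by simp
qed

section \<open>Length in the simple generators and faithfulness of the action\<close>

definition len :: "'a \<Rightarrow> nat" where
  "len g = (LEAST k. \<exists>u \<in> lists {..<n}. length u = k \<and> ev u = g)"

lemma len_le: "u \<in> lists {..<n} \<Longrightarrow> len (ev u) \<le> length u"
  unfolding len_def by (rule Least_le) blast

lemma len_word: "g \<in> carrier G \<Longrightarrow> \<exists>u \<in> lists {..<n}. length u = len g \<and> ev u = g"
  unfolding len_def by (rule LeastI_ex) (use ex_word in blast)

lemma len_mult_simple_le: "g \<in> carrier G \<Longrightarrow> k < n \<Longrightarrow> len (g \<otimes> s k) \<le> len g + 1"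
proof -
  assume g: "g \<in> carrier G" and k: "k < n"
  obtain u where u: "u \<in> lists {..<n}" "length u = len g" "ev u = g" using len_word[OF g] by blast
  then have "ev (u @ [k]) = g \<otimes> s k" using k simple_closed[of k] by (subst ev_append) auto
  then show ?thesis using len_le[of "u @ [k]"] u k by simp
qed

text \<open>All relators have even length, so the parity of a word depends only on the group
  element; thus a simple factor never leaves the length unchanged.\<close>

lemma len_mult_simple_parity:
  "g \<in> carrier G \<Longrightarrow> k < n \<Longrightarrow> even (len (g \<otimes> s k)) \<longleftrightarrow> odd (len g)"
proof -
  assume g: "g \<in> carrier G" and k: "k < n"
  have gk: "g \<otimes> s k \<in> carrier G" using g k simple_closed by simp
  obtain u where u: "u \<in> lists {..<n}" "length u = len g" "ev u = g" using len_word[OF g] by blast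
  obtain v where v: "v \<in> lists {..<n}" "length v = len (g \<otimes> s k)" "ev v = g \<otimes> s k"
    using len_word[OF gk] by blast
  have "ev (u @ [k]) = g \<otimes> s k" using k u simple_closed[of k] by (subst ev_append) auto
  then have "ev v = ev (u @ [k])" using v by simp
  moreover have "u @ [k] \<in> lists {..<n}" using u k by simp
  ultimately have "coxeter_word_eq {..<n} (type_D n) v (u @ [k])"
    using presentation v(1) by blast
  from coxeter_word_eq_parity[OF this] show ?thesis using u v by simp
qed

lemma ex_descent: "g \<in> carrier G \<Longrightarrow> g \<noteq> \<one> \<Longrightarrow> \<exists>k<n. len (g \<otimes> s k) < len g"
proof -
  assume g: "g \<in> carrier G" "g \<noteq> \<one>"
  obtain u where u: "u \<in> lists {..<n}" "length u = len g" "ev u = g" using len_word[OF g(1)] by blast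
  then have "u \<noteq> []" using g by auto
  then obtain v k where v: "u = v @ [k]" by (metis rev_exhaust)
  then have k: "k < n" "v \<in> lists {..<n}" using u by auto
  then have "g = ev v \<otimes> s k"
    using u(3) v simple_closed[of k] ev_append[of v "[k]"] by simp
  then have "g \<otimes> s k = ev v"
    using k simple_closed simple_square by (simp add: m_assoc)
  then have "len (g \<otimes> s k) < len g" using len_le[OF k(2)] u v by simp
  then show ?thesis using k by blast
qed

lemma mult_simple_simple [simp]: "g \<in> carrier G \<Longrightarrow> k < n \<Longrightarrow> g \<otimes> s k \<otimes> s k = g"
  using simple_square[of k] simple_closed[of k] by (simp add: m_assoc)

lemma simple_commute: "i < n \<Longrightarrow> j < n \<Longrightarrow> type_D n i j = 2 \<Longrightarrow> s i \<otimes> s j = s j \<otimes> s i"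
proof -
  assume a: "i < n" "j < n" "type_D n i j = 2"
  then have "ev [i, j, i, j] = ev []"
    using presentation[of "[i, j, i, j]" "[]"] coxeter_word_eq.relator[of i "{..<n}" j "type_D n"]
    by (simp add: numeral_2_eq_2)
  then have "s i \<otimes> s j \<otimes> s i \<otimes> s j = \<one>"
    using a simple_closed by (simp add: m_assoc)
  then have "s i \<otimes> s j \<otimes> s i \<otimes> s j \<otimes> s j \<otimes> s i = s j \<otimes> s i"
    using a simple_closed by (simp add: m_assoc)
  then show ?thesis using a simple_closed by simp
qed

lemma simple_braid:
  "i < n \<Longrightarrow> j < n \<Longrightarrow> type_D n i j = 3 \<Longrightarrow> s i \<otimes> s j \<otimes> s i = s j \<otimes> s i \<otimes> s j"
proof -
  assume a: "i < n" "j < n" "type_D n i j = 3"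
  then have "ev [i, j, i, j, i, j] = ev []"
    using presentation[of "[i, j, i, j, i, j]" "[]"] coxeter_word_eq.relator[of i "{..<n}" j "type_D n"]
    by (simp add: numeral_3_eq_3)
  then have "s i \<otimes> s j \<otimes> s i \<otimes> s j \<otimes> s i \<otimes> s j = \<one>"
    using a simple_closed by (simp add: m_assoc)
  then have "s i \<otimes> s j \<otimes> s i \<otimes> s j \<otimes> s i \<otimes> s j \<otimes> s j \<otimes> s i \<otimes> s j = s j \<otimes> s i \<otimes> s j"
    using a simple_closed by (simp add: m_assoc)
  then show ?thesis using a simple_closed by simp
qed

text \<open>
  With \<open>e\<^bsub>-a\<^esub> = - e\<^sub>a\<close>, the roots are \<open>e\<^sub>a - e\<^sub>b\<close>.  The nodes are numbered against the letters so that such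
  a root is positive iff \<open>a > b\<close>; the conclusion says that \<open>g\<close> maps the \<open>k\<close>-th simple root to a positive one.
\<close>

lemma positive_root_of_ascent:
  "g \<in> carrier G \<Longrightarrow> k < n \<Longrightarrow> len (g \<otimes> s k) > len g \<Longrightarrow>
     phi g (root_fst n k) > phi g (root_snd n k)"
proof (induction "len g" arbitrary: g k rule: less_induct)
  case less
  note g = less.prems(1) and k = less.prems(2) and up = less.prems(3)
  note IH = less.hyps
  show ?case
  proof (cases "g = \<one>")
    case True
    then show ?thesis using simple_root_gt[OF n4 k] by (simp add: phi_one)
  next
    case False
    then obtain j where j: "j < n" "len (g \<otimes> s j) < len g" using ex_descent g by blast
    define v where "v = g \<otimes> s j"
    have v: "v \<in> carrier G" "g = v \<otimes> s j" "len v < len g" using g j simple_closed by (auto simp: v_def)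
    have len_g: "len g = len v + 1" using len_mult_simple_le[OF v(1) j(1)] v by simp
    have up_j: "len (v \<otimes> s j) > len v" using v by simp
    have phi_g: "phi g x = phi v (simple_perm n j x)" for x
      using phi_mult[OF v(1) simple_closed, of j] j v(2) by (simp add: phi_simple)
    note odd = signed_perm_odd[OF signed_perm_phi]
    have sc: "s k \<in> carrier G" "s j \<in> carrier G" using k j simple_closed by auto
    from type_D_cases[of n k j] consider "k = j" | "k \<noteq> j" "type_D n k j = 2" | "k \<noteq> j" "type_D n k j = 3"
      by blast
    then show ?thesis
    proof cases
      case 1
      then show ?thesis using up j by simp
    next
      case 2
      \<comment> \<open>Since \<open>s k\<close> and \<open>s j\<close> commute, a descent of
        \<open>v\<close> at \<open>k\<close> would make \<open>g \<otimes> s k\<close> no longer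
        than \<open>g\<close>.\<close>
      have "len (v \<otimes> s k) > len v"
      proof (rule ccontr)
        assume "\<not> len (v \<otimes> s k) > len v"
        moreover have "g \<otimes> s k = v \<otimes> s k \<otimes> s j"
          using simple_commute[OF k j(1) 2(2)] v sc by (simp add: m_assoc)
        moreover have "len (v \<otimes> s k \<otimes> s j) \<le> len (v \<otimes> s k) + 1"
          using v sc j by (intro len_mult_simple_le) auto
        ultimately show False using up len_g by simp
      qed
      from IH[OF v(3) v(1) k this] show ?thesis
        using type_D_nonadjacent[OF n4 k j(1) 2] phi_g odd[OF v(1)] by auto
    next
      case 3
      note ad = type_D_adjacent[OF n4 k j(1) 3(2)]
      note rk = rootsD[OF simple_root[OF n4 k]] and rj = rootsD[OF simple_root[OF n4 j(1)]]
      note pj = simple_perm_root[OF n4 j(1)] and pk = simple_perm_root[OF n4 k]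
      show ?thesis
      proof (cases "len (v \<otimes> s k) > len v")
        \<comment> \<open>Both simple roots are sent to positive roots by \<open>v\<close>, and
          \<open>s j\<close> sends the \<open>k\<close>-th root to the sum of the two; positivity of
          a sum is transitivity of \<open>>\<close> on the entries.\<close>
        case True
        note a = IH[OF v(3) v(1) k True] IH[OF v(3) v(1) j(1) up_j]
        from ad show ?thesis
        proof
          assume h: "root_snd n k = root_fst n j \<and> \<bar>root_fst n k\<bar> \<noteq> \<bar>root_snd n j\<bar>"
          then have "simple_perm n j (root_fst n k) = root_fst n k"
            using rk rj by (simp add: simple_perm_def sswap_other)
          then show ?thesis using a h phi_g pj by simp
        next
          assume h: "root_snd n j = root_fst n k \<and> \<bar>root_fst n j\<bar> \<noteq> \<bar>root_snd n k\<bar>"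
          then have "simple_perm n j (root_snd n k) = root_snd n k"
            using rk rj by (simp add: simple_perm_def sswap_other)
          then show ?thesis using a h phi_g pj by (metis order.strict_trans)
        qed
      next
        \<comment> \<open>Now \<open>g = u \<otimes> s k \<otimes> s j\<close>, and
          \<open>s k \<otimes> s j\<close> sends the \<open>k\<close>-th simple root to the
          \<open>j\<close>-th one. So it is enough that \<open>u\<close> ascends at
          \<open>j\<close>; otherwise the braid relation would shorten
          \<open>g \<otimes> s k\<close>.\<close>
        case False
        define u where "u = v \<otimes> s k"
        have u: "u \<in> carrier G" "v = u \<otimes> s k" using v sc k by (auto simp: u_def)
        have "len u \<noteq> len v" using len_mult_simple_parity[OF v(1) k] by (auto simp: u_def)
        then have len_v: "len v = len u + 1"
          using False len_mult_simple_le[OF u(1) k] unfolding u(2)[symmetric] u_def[symmetric]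
          by linarith
        have "len (u \<otimes> s j) > len u"
        proof (rule ccontr)
          assume n: "\<not> len (u \<otimes> s j) > len u"
          moreover have "len (u \<otimes> s j) \<noteq> len u" using len_mult_simple_parity[OF u(1) j(1)] by auto
          moreover have "g \<otimes> s k = u \<otimes> s j \<otimes> s k \<otimes> s j"
            using simple_braid[OF k j(1) 3(2)] u v(2) sc by (simp add: m_assoc)
          moreover have "len (u \<otimes> s j \<otimes> s k \<otimes> s j) \<le> len (u \<otimes> s j \<otimes> s k) + 1"
            using u sc j by (intro len_mult_simple_le) auto
          moreover have "len (u \<otimes> s j \<otimes> s k) \<le> len (u \<otimes> s j) + 1"
            using u sc k by (intro len_mult_simple_le) auto
          ultimately show False using up len_g len_v by simp
        qed
        then have a: "phi u (root_fst n j) > phi u (root_snd n j)"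
          using IH[of u j] u(1) j(1) len_g len_v by simp
        have phi_g': "phi g x = phi u (simple_perm n k (simple_perm n j x))" for x
          using phi_mult[OF u(1) simple_closed, of k] k u(2) phi_g by (simp add: phi_simple)
        from ad show ?thesis
        proof
          assume h: "root_snd n k = root_fst n j \<and> \<bar>root_fst n k\<bar> \<noteq> \<bar>root_snd n j\<bar>"
          then have "simple_perm n j (root_fst n k) = root_fst n k"
            "simple_perm n k (root_snd n j) = root_snd n j"
            using rk rj by (simp_all add: simple_perm_def sswap_other)
          then show ?thesis using a h phi_g' pj pk by simp
        next
          assume h: "root_snd n j = root_fst n k \<and> \<bar>root_fst n j\<bar> \<noteq> \<bar>root_snd n k\<bar>"
          then have "simple_perm n j (root_snd n k) = root_snd n k"
            "simple_perm n k (root_fst n j) = root_fst n j"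
            using rk rj by (simp_all add: simple_perm_def sswap_other)
          moreover have "simple_perm n j (root_fst n k) = root_fst n j" using h pj by metis
          ultimately show ?thesis using a h phi_g' pk by simp
        qed
      qed
    qed
  qed
qed

text \<open>A descent \<open>k\<close> of \<open>g\<close> is an ascent of
  \<open>g \<otimes> s k\<close>. If \<open>g\<close> acts trivially, then
  \<open>g \<otimes> s k\<close> acts as the \<open>k\<close>-th simple reflection and makes the
  \<open>k\<close>-th simple root negative.\<close>

lemma phi_kernel: "g \<in> carrier G \<Longrightarrow> phi g = id \<Longrightarrow> g = \<one>"
proof (rule ccontr)
  assume g: "g \<in> carrier G" "phi g = id" "g \<noteq> \<one>"
  then obtain k where k: "k < n" "len (g \<otimes> s k) < len g" using ex_descent by blast
  have gk: "g \<otimes> s k \<in> carrier G" using g k simple_closed by simp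
  have "phi (g \<otimes> s k) (root_fst n k) > phi (g \<otimes> s k) (root_snd n k)"
    using g k by (intro positive_root_of_ascent gk) simp_all
  moreover have "phi (g \<otimes> s k) x = simple_perm n k x" for x
    using g k simple_closed[of k] by (simp add: phi_mult phi_simple)
  ultimately show False
    using simple_root_gt[OF n4 k(1)] simple_perm_root[OF n4 k(1)] by simp
qed

lemma phi_inv: "g \<in> carrier G \<Longrightarrow> phi (inv g) \<circ> phi g = id" "g \<in> carrier G \<Longrightarrow> phi g \<circ> phi (inv g) = id"
  using phi_mult[of "inv g" g] phi_mult[of g "inv g"] by (simp_all add: phi_one)

lemma phi_inj:
  assumes "g \<in> carrier G" "h \<in> carrier G" "phi g = phi h"
  shows "g = h"
proof -
  have "phi (inv h \<otimes> g) = id" using assms phi_inv(1)[of h] by (simp add: phi_mult)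
  then have "inv h \<otimes> g = \<one>" using assms by (intro phi_kernel) auto
  then have "h \<otimes> (inv h \<otimes> g) = h" using assms by simp
  then show ?thesis using assms by (simp flip: m_assoc)
qed

end

section \<open>Factorizations of an element with two negative cycles\<close>

lemma chain_append2: "chain (xs @ [x, y]) = chain (xs @ [x]) @ [(x, y)]"
  by (induction xs rule: induct_list012) auto

lemma chain_conv_nth: "chain xs = map (\<lambda>k. (xs ! k, xs ! Suc k)) [0..<length xs - 1]"
  by (rule nth_equalityI) (auto simp: chain_def nth_tl)

lemma chain_set: "(x, y) \<in> set (chain xs) \<Longrightarrow> x \<in> set xs \<and> y \<in> set xs"
  by (induction xs rule: induct_list012) auto

lemma signed_cycle_iff_chain:
  "signed_cycle f xs e \<longleftrightarrow> xs \<noteq> [] \<and> distinct (map abs xs) \<and>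
     (\<forall>(x, y) \<in> set (chain xs). f x = y) \<and> f (last xs) = e * hd xs"
proof -
  have "set (chain xs) = {(xs ! i, xs ! Suc i) | i. Suc i < length xs}"
    unfolding chain_conv_nth by (auto simp: image_iff)
  then show ?thesis unfolding signed_cycle_def by auto
qed

lemma distinct_supp_disjoint:
  assumes "distinct (map abs (xs @ ys))"
  shows "x \<in> set xs \<Longrightarrow> x \<notin> supp ys" "y \<in> set ys \<Longrightarrow> y \<notin> supp xs"
  using assms unfolding supp_def by auto

lemma rprod_conj:
  assumes "signed_perm n h"
  shows "h \<circ> rprod ps = rprod (map (map_prod h h) ps) \<circ> h"
proof (induction ps)
  case (Cons p ps)
  have "h \<circ> rprod (p # ps) = (h \<circ> sswap (fst p) (snd p)) \<circ> rprod ps"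
    by (simp add: o_assoc del: comp_apply)
  also have "\<dots> = sswap (h (fst p)) (h (snd p)) \<circ> (h \<circ> rprod ps)"
    by (simp only: signed_perm_sswap_conj[OF assms] o_assoc)
  also have "\<dots> = rprod (map (map_prod h h) (p # ps)) \<circ> h"
    by (simp only: Cons) (simp add: o_assoc del: comp_apply)
  finally show ?case .
qed simp

lemma map_prod_roots:
  assumes "signed_perm n h" "set ps \<subseteq> roots n"
  shows "set (map (map_prod h h) ps) \<subseteq> roots n"
  using assms signed_perm_roots[OF assms(1)] by (auto simp: subset_iff)

text \<open>The two chains give positive cycles. The last two reflections multiply to the sign
  change of both last letters, which makes both cycles negative at once. The count is
  \<open>(length xs - 1) + (length ys - 1) + 2 = n\<close>.\<close>

lemma two_cycles_rprod:
  assumes f: "signed_perm n f" and xs: "signed_cycle f xs (- 1)" and ys: "signed_cycle f ys (- 1)"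
    and d: "distinct (map abs (xs @ ys))" and s: "supp (xs @ ys) = pts n"
  defines "ps \<equiv> chain xs @ chain ys @ [(last xs, last ys), (last xs, - last ys)]"
  shows "f = rprod ps" "set ps \<subseteq> roots n" "length ps = n"
proof -
  let ?a = "last xs" and ?b = "last ys"
  let ?X = "rprod (chain xs)" and ?Y = "rprod (chain ys)"
  let ?N = "sswap ?a ?b \<circ> sswap ?a (- ?b)"
  have ne: "xs \<noteq> []" "ys \<noteq> []" using xs ys by (auto simp: signed_cycle_def)
  have sub: "set xs \<subseteq> pts n" "set ys \<subseteq> pts n"
    unfolding s[symmetric] subset_iff supp_iff by auto
  have 0: "0 \<notin> set xs" "0 \<notin> set ys" using sub by auto
  have in_set: "?a \<in> set xs" "?b \<in> set ys" using ne by auto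
  have ab: "?a \<noteq> 0" "?b \<noteq> 0" "\<bar>?a\<bar> \<noteq> \<bar>?b\<bar>"
    using in_set 0 d by (metis, metis, auto)
  have dd: "distinct (map abs xs)" "distinct (map abs ys)" using d by auto
  have "(?a, ?b) \<in> roots n" "(?a, - ?b) \<in> roots n" using in_set sub ab by (auto simp: roots_def)
  then show roots: "set ps \<subseteq> roots n"
    unfolding ps_def using set_chain_roots[OF dd(1) sub(1)] set_chain_roots[OF dd(2) sub(2)] by simp
  have "2 * n = 2 * (length xs + length ys)"
    using card_supp[OF d] 0 by (simp add: s card_pts del: supp_simps)
  then show "length ps = n"
    using ne by (cases xs; cases ys) (auto simp: ps_def)
  have g: "signed_perm n (rprod ps)" by (rule signed_perm_rprod[OF roots])
  have gX: "signed_perm n ?X" and gY: "signed_perm n ?Y"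
    using set_chain_roots[OF dd(1) sub(1)] set_chain_roots[OF dd(2) sub(2)] signed_perm_rprod by auto
  have eq: "rprod ps z = ?X (?Y (?N z))" for z by (simp add: ps_def rprod_append)
  have Na: "?N ?a = - ?a" "?N ?b = - ?b" using ab by (auto simp: sswap_def)
  have N: "?N z = z" if "\<bar>z\<bar> \<noteq> \<bar>?a\<bar>" "\<bar>z\<bar> \<noteq> \<bar>?b\<bar>" for z
    using that by (simp add: sswap_other)
  note dx = distinct_supp_disjoint(1)[OF d] and dy = distinct_supp_disjoint(2)[OF d]
  note cX = signed_cycle_chain[OF ne(1) dd(1) 0(1)] and cY = signed_cycle_chain[OF ne(2) dd(2) 0(2)]
  have "signed_cycle (rprod ps) xs (- 1)"
    unfolding signed_cycle_def
  proof (intro conjI allI impI)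
    fix i assume i: "Suc i < length xs"
    then have z: "xs ! i \<in> set xs" "\<bar>xs ! i\<bar> \<noteq> \<bar>?a\<bar>"
      using dd(1) ne by (auto simp: last_conv_nth distinct_conv_nth)
    moreover have "\<bar>xs ! i\<bar> \<noteq> \<bar>?b\<bar>" using dx[OF z(1)] in_set(2) by (auto simp: supp_def)
    ultimately have "rprod ps (xs ! i) = ?X (xs ! i)"
      unfolding eq using N[of "xs ! i"] rprod_chain_fix[OF dx[OF z(1)]] by simp
    then show "rprod ps (xs ! i) = xs ! Suc i" using cX i by (simp add: signed_cycle_def)
  next
    have "?Y (- ?a) = - ?a" using dx[OF in_set(1)] by (intro rprod_chain_fix) simp
    then show "rprod ps (last xs) = - 1 * hd xs"
      unfolding eq Na using cX signed_perm_odd[OF gX] by (simp add: signed_cycle_def)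
  qed (use ne dd in auto)
  from signed_cycle_agree[OF xs this f g] have 1: "f z = rprod ps z" if "z \<in> supp xs" for z
    using that by simp
  have "signed_cycle (rprod ps) ys (- 1)"
    unfolding signed_cycle_def
  proof (intro conjI allI impI)
    fix i assume i: "Suc i < length ys"
    then have z: "ys ! i \<in> set ys" "ys ! Suc i \<in> set ys" "\<bar>ys ! i\<bar> \<noteq> \<bar>?b\<bar>"
      using dd(2) ne by (auto simp: last_conv_nth distinct_conv_nth)
    moreover have "\<bar>ys ! i\<bar> \<noteq> \<bar>?a\<bar>" using dy[OF z(1)] in_set(1) by (auto simp: supp_def)
    ultimately have "rprod ps (ys ! i) = ?X (?Y (ys ! i))"
      unfolding eq using N[of "ys ! i"] by simp
    also have "?Y (ys ! i) = ys ! Suc i" using cY i by (simp add: signed_cycle_def)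
    finally show "rprod ps (ys ! i) = ys ! Suc i" using dy[OF z(2)] by (simp add: rprod_chain_fix)
  next
    have "?Y (- ?b) = - hd ys" using cY signed_perm_odd[OF gY] by (simp add: signed_cycle_def)
    moreover have "?X (- hd ys) = - hd ys" using dy[of "hd ys"] ne by (intro rprod_chain_fix) simp
    ultimately show "rprod ps (last ys) = - 1 * hd ys"
      unfolding eq Na by simp
  qed (use ne dd in auto)
  from signed_cycle_agree[OF ys this f g] have 2: "f z = rprod ps z" if "z \<in> supp ys" for z
    using that by simp
  show "f = rprod ps"
  proof
    fix z
    show "f z = rprod ps z"
    proof (cases "z \<in> pts n")
      case True
      then show ?thesis using 1 2 unfolding s[symmetric] by auto
    next
      case False
      then show ?thesis using signed_perm_fix[OF f] signed_perm_fix[OF g] by simp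
    qed
  qed
qed

lemma abs_neqD:
  fixes a b :: int
  assumes "\<bar>a\<bar> \<noteq> \<bar>b\<bar>"
  shows "a \<noteq> b" "b \<noteq> a" "a \<noteq> - b" "b \<noteq> - a" "- a \<noteq> b" "- b \<noteq> a"
  using assms by auto

text \<open>The factors \<open>(a, b)\<close> and \<open>(a, - b)\<close> form the sign change of
  \<open>a\<close> and \<open>b\<close>. Moving it past \<open>(d, b)\<close> turns either that
  reflection into \<open>(d, - b)\<close> or the sign change into that of \<open>a\<close> and
  \<open>d\<close>. Splitting off the last factor leaves the two elements of length 3.\<close>

lemma sswap_four_eq:
  assumes nz: "c \<noteq> 0" "a \<noteq> 0" "d \<noteq> 0" "b \<noteq> 0"
    and ne: "\<bar>c\<bar> \<noteq> \<bar>a\<bar>" "\<bar>c\<bar> \<noteq> \<bar>d\<bar>" "\<bar>c\<bar> \<noteq> \<bar>b\<bar>" "\<bar>a\<bar> \<noteq> \<bar>d\<bar>" "\<bar>a\<bar> \<noteq> \<bar>b\<bar>" "\<bar>d\<bar> \<noteq> \<bar>b\<bar>"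
  shows "rprod [(c, a), (d, b), (a, b), (a, - b)] = rprod [(c, a), (a, b), (a, - b), (d, - b)]" (is ?A)
    and "rprod [(c, a), (d, b), (a, b), (a, - b)] = rprod [(c, a), (a, d), (a, - d), (d, b)]" (is ?B)
proof -
  note n = nz ne[THEN abs_neqD(1)] ne[THEN abs_neqD(2)] ne[THEN abs_neqD(3)] ne[THEN abs_neqD(4)]
    ne[THEN abs_neqD(5)] ne[THEN abs_neqD(6)]
  have cases: "z \<in> {c, - c, a, - a, d, - d, b, - b} \<or>
      \<bar>z\<bar> \<noteq> \<bar>c\<bar> \<and> \<bar>z\<bar> \<noteq> \<bar>a\<bar> \<and> \<bar>z\<bar> \<noteq> \<bar>d\<bar> \<and> \<bar>z\<bar> \<noteq> \<bar>b\<bar>" for z :: int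
    by (auto simp: abs_eq_iff)
  show ?A
  proof
    fix z show "rprod [(c, a), (d, b), (a, b), (a, - b)] z = rprod [(c, a), (a, b), (a, - b), (d, - b)] z"
      using cases[of z] by (elim disjE insertE emptyE) (simp_all add: sswap_other, simp_all add: sswap_def n)
  qed
  show ?B
  proof
    fix z show "rprod [(c, a), (d, b), (a, b), (a, - b)] z = rprod [(c, a), (a, d), (a, - d), (d, b)] z"
      using cases[of z] by (elim disjE insertE emptyE) (simp_all add: sswap_other, simp_all add: sswap_def n)
  qed
qed

text \<open>The negative cycle on \<open>c\<close>, \<open>a\<close> times the sign change of
  \<open>b\<close> can start with the reflection in \<open>e_c - e_a\<close> or in
  \<open>e_c + e_a\<close>; this places both reflections below the same element.\<close>

lemma sswap_three_eq:
  assumes nz: "c \<noteq> 0" "a \<noteq> 0" "b \<noteq> 0" and ne: "\<bar>c\<bar> \<noteq> \<bar>a\<bar>" "\<bar>c\<bar> \<noteq> \<bar>b\<bar>" "\<bar>a\<bar> \<noteq> \<bar>b\<bar>"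
  shows "rprod [(a, - c), (c, b), (c, - b)] = rprod [(c, a), (a, b), (a, - b)]"
proof
  note n = nz ne[THEN abs_neqD(1)] ne[THEN abs_neqD(2)] ne[THEN abs_neqD(3)] ne[THEN abs_neqD(4)]
    ne[THEN abs_neqD(5)] ne[THEN abs_neqD(6)]
  fix z
  have "z \<in> {c, - c, a, - a, b, - b} \<or> \<bar>z\<bar> \<noteq> \<bar>c\<bar> \<and> \<bar>z\<bar> \<noteq> \<bar>a\<bar> \<and> \<bar>z\<bar> \<noteq> \<bar>b\<bar>"
    by (auto simp: abs_eq_iff)
  then show "rprod [(a, - c), (c, b), (c, - b)] z = rprod [(c, a), (a, b), (a, - b)] z"
    by (elim disjE insertE emptyE) (simp_all add: sswap_other, simp_all add: sswap_def n)
qed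

lemma num_classes_le_2:
  assumes "equiv UNIV E" "\<And>z. z \<in> P \<Longrightarrow> (u, z) \<in> E \<or> (v, z) \<in> E"
  shows "num_classes P E \<le> 2"
proof -
  have "(\<lambda>x. E `` {x}) ` P \<subseteq> {E `` {u}, E `` {v}}"
    using assms(2) equiv_class_eq[OF assms(1)] by blast
  then have "num_classes P E \<le> card {E `` {u}, E `` {v}}"
    unfolding num_classes_def by (intro card_mono) auto
  also have "\<dots> \<le> 2" by (simp add: card_insert_if)
  finally show ?thesis .
qed

lemma signed_cycle_connected:
  assumes f: "signed_perm n f" and c: "signed_cycle f xs (- 1)" and z: "z \<in> supp xs"
  shows "(hd xs, z) \<in> orbit_rel f"
proof -
  note e = equivD[OF equiv_orbit_rel[of f]]
  have ne: "xs \<noteq> []" using c by (simp add: signed_cycle_def)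
  have 1: "(hd xs, xs ! i) \<in> orbit_rel f \<and> (- hd xs, - (xs ! i)) \<in> orbit_rel f" if "i < length xs" for i
    using that
  proof (induction i)
    case 0
    then show ?case using ne e(1) by (simp add: hd_conv_nth)
  next
    case (Suc i)
    then have "f (xs ! i) = xs ! Suc i" using c by (simp add: signed_cycle_def)
    then have "(xs ! i, xs ! Suc i) \<in> orbit_rel f" "(- (xs ! i), - (xs ! Suc i)) \<in> orbit_rel f"
      using orbit_rel_step[of "xs ! i" f] orbit_rel_step[of "- (xs ! i)" f] signed_perm_odd[OF f] by simp_all
    then show ?case using Suc e(3) by (meson Suc_lessD)
  qed
  have "(last xs, - hd xs) \<in> orbit_rel f"
    using orbit_rel_step[of "last xs" f] c by (simp add: signed_cycle_def)
  moreover have "(hd xs, last xs) \<in> orbit_rel f"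
    using 1[of "length xs - 1"] ne by (simp add: last_conv_nth)
  ultimately have 2: "(hd xs, - hd xs) \<in> orbit_rel f" by (rule e(3)[rotated])
  from z obtain x where x: "x \<in> set xs" "z = x \<or> z = - x" unfolding supp_iff by blast
  then obtain i where "i < length xs" "x = xs ! i" by (auto simp: in_set_conv_nth)
  then show ?thesis using 1[of i] e(3)[OF 2] x by auto
qed

text \<open>
  The flipped cycle stays negative because two of its signs change; with \<open>c\<close> and \<open>a\<close> in different cycles,
  both cycles would become positive.
\<close>

lemma num_classes_flip_le_2:
  assumes f: "signed_perm n f" and xs: "signed_cycle f (xs @ [c, a]) (- 1)" and ys: "signed_cycle f ys (- 1)"
    and d: "distinct (map abs ((xs @ [c, a]) @ ys))" and s: "supp ((xs @ [c, a]) @ ys) = pts n"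
  shows "num_classes (pts n) (orbit_rel (rprod [(c, a), (a, - c)] \<circ> f)) \<le> 2"
proof -
  let ?N = "rprod [(c, a), (a, - c)]"
  let ?g = "?N \<circ> f"
  have mem: "c \<in> pts n" "a \<in> pts n" unfolding s[symmetric] by auto
  then have ca: "c \<noteq> 0" "a \<noteq> 0" "\<bar>c\<bar> \<noteq> \<bar>a\<bar>" using d by (auto simp: pts_def)
  have N: "?N c = - c" "?N a = - a" "?N (- a) = a" "?N (- c) = c" using ca by (auto simp: sswap_def)
  have Nf: "?N z = z" if "\<bar>z\<bar> \<noteq> \<bar>c\<bar>" "\<bar>z\<bar> \<noteq> \<bar>a\<bar>" for z
    using that by (simp add: sswap_other)
  have "set [(c, a), (a, - c)] \<subseteq> roots n" using mem ca by (auto simp: roots_def)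
  then have g: "signed_perm n ?g" by (intro signed_perm_comp signed_perm_rprod f)
  note odd = signed_perm_odd[OF f] and Nodd = signed_perm_odd[OF signed_perm_rprod[OF \<open>set _ \<subseteq> _\<close>]]
  have Nxs: "?N z = z" if "z \<in> set xs" for z
  proof -
    have "\<bar>z\<bar> \<in> abs ` set xs" using that by (rule imageI)
    then show ?thesis using d by (intro Nf) auto
  qed
  have Nys: "?N z = z" if "z \<in> set ys" for z
  proof -
    have "\<bar>z\<bar> \<in> abs ` set ys" using that by (rule imageI)
    then show ?thesis using d by (intro Nf) auto
  qed
  have "signed_cycle ?g ys (- 1)"
  proof -
    have "?g x = y" if "(x, y) \<in> set (chain ys)" for x y
      using that ys chain_set[OF that] Nys unfolding signed_cycle_iff_chain by fastforce
    moreover have "?g (last ys) = - 1 * hd ys"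
      using ys Nys[of "hd ys"] Nodd by (simp add: signed_cycle_def del: rprod_simps)
    ultimately show ?thesis using ys unfolding signed_cycle_iff_chain by auto
  qed
  \<comment> \<open>The step into \<open>c\<close> now ends at \<open>- c\<close>, whose image
    \<open>- a\<close> is flipped back to \<open>a\<close>; from there on the signs agree again. If
    \<open>xs\<close> is empty, the closing step is flipped together with the head.\<close>
  moreover have "signed_cycle ?g (xs @ [- c, a]) (- 1)"
  proof (cases xs rule: rev_cases)
    case Nil
    then show ?thesis
      using xs ca N Nodd odd unfolding signed_cycle_iff_chain by (simp del: rprod_simps)
  next
    case (snoc zs b)
    have c0: "chain (xs @ [u, v]) = chain xs @ [(b, u), (u, v)]" for u v
      using chain_append2[of xs u v] chain_append2[of zs b u] by (simp add: snoc)
    have ch: "?g x = y" if xy: "(x, y) \<in> set (chain xs)" for x y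
    proof -
      have "(x, y) \<in> set (chain (xs @ [c, a]))"
        using xy unfolding c0 by simp
      moreover have "\<forall>(x, y) \<in> set (chain (xs @ [c, a])). f x = y"
        using xs unfolding signed_cycle_iff_chain by (elim conjE) assumption
      ultimately have "f x = y" by fast
      then show ?thesis using Nxs[OF conjunct2[OF chain_set[OF xy]]] by (simp only: comp_apply)
    qed

    have fb: "f b = c" "f c = a" "f a = - hd (xs @ [c, a])"
      using xs unfolding signed_cycle_iff_chain c0 by auto
    have "xs \<noteq> []" using snoc by simp
    then have hd: "hd (xs @ [u, a]) = hd xs" "hd xs \<in> set xs" for u by simp_all
    then have "?g a = - hd xs" using fb Nodd Nxs[of "hd xs"] by (simp del: rprod_simps)
    moreover have "?g b = - c" "?g (- c) = a" using fb N odd by (simp_all del: rprod_simps)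
    ultimately show ?thesis
      unfolding signed_cycle_iff_chain c0 hd using ch d by auto
  qed
  ultimately have "(hd (xs @ [- c, a]), z) \<in> orbit_rel ?g \<or> (hd ys, z) \<in> orbit_rel ?g" if "z \<in> pts n" for z
    using that signed_cycle_connected[OF g] unfolding s[symmetric] by auto
  then show ?thesis by (rule num_classes_le_2[OF equiv_orbit_rel])
qed

text \<open>The left-hand side of \<open>eq\<close> moves only the points of two absolute values.\<close>

lemma sswap_flip_sswap:
  assumes ca: "c \<noteq> 0" "a \<noteq> 0" "\<bar>c\<bar> \<noteq> \<bar>a\<bar>" and pq: "p \<noteq> 0" "q \<noteq> 0" "\<bar>p\<bar> \<noteq> \<bar>q\<bar>"
    and eq: "sswap r t = sswap c a \<circ> (sswap a (- c) \<circ> sswap p q)"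
  shows "sswap p q = sswap a c \<or> sswap p q = sswap a (- c)"
proof -
  have mv: False if "sswap r t x \<noteq> x" "sswap r t y \<noteq> y" "sswap r t z \<noteq> z"
      "\<bar>x\<bar> \<noteq> \<bar>y\<bar>" "\<bar>x\<bar> \<noteq> \<bar>z\<bar>" "\<bar>y\<bar> \<noteq> \<bar>z\<bar>" for x y z
  proof -
    have "\<bar>u\<bar> = \<bar>r\<bar> \<or> \<bar>u\<bar> = \<bar>t\<bar>" if "sswap r t u \<noteq> u" for u
      using that sswap_other[of u r t] by blast
    from this[OF that(1)] this[OF that(2)] this[OF that(3)] that(4-6) show False by auto
  qed
  define N where "N x = sswap c a (sswap a (- c) x)" for x
  have N: "N x = (if \<bar>x\<bar> = \<bar>c\<bar> \<or> \<bar>x\<bar> = \<bar>a\<bar> then - x else x)" for x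
    using ca unfolding N_def by (auto simp: sswap_def abs_eq_iff)
  have r: "sswap r t x = N (sswap p q x)" for x by (simp add: eq N_def)
  have moved: "sswap r t p \<noteq> p" "sswap r t q \<noteq> q"
    using pq sswap_apply[OF pq] unfolding r N by (auto simp: abs_eq_iff)
  have moved': "sswap r t x \<noteq> x" if "\<bar>x\<bar> = \<bar>c\<bar> \<or> \<bar>x\<bar> = \<bar>a\<bar>" "\<bar>x\<bar> \<noteq> \<bar>p\<bar>" "\<bar>x\<bar> \<noteq> \<bar>q\<bar>" for x
    using that ca unfolding r N by (auto simp: sswap_other)
  \<comment> \<open>The points \<open>p\<close> and \<open>q\<close> are moved, and so is
    \<open>c\<close> or \<open>a\<close> if its absolute value differs from both; that would be a
    third absolute value moved by one reflection.\<close>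
  have "\<bar>c\<bar> = \<bar>p\<bar> \<or> \<bar>c\<bar> = \<bar>q\<bar>" "\<bar>a\<bar> = \<bar>p\<bar> \<or> \<bar>a\<bar> = \<bar>q\<bar>"
    using mv[OF moved moved'[of c] pq(3)] mv[OF moved moved'[of a] pq(3)] by metis+
  then have "(p = a \<or> p = - a) \<and> (q = c \<or> q = - c) \<or> (p = c \<or> p = - c) \<and> (q = a \<or> q = - a)"
    using ca pq by (auto simp: abs_eq_iff)
  moreover have "sswap (- a) (- c) = sswap a c" "sswap c a = sswap a c" "sswap (- c) (- a) = sswap a c"
    "sswap (- a) c = sswap a (- c)" "sswap (- c) a = sswap a (- c)" "sswap c (- a) = sswap a (- c)"
    using ca by (auto simp: fun_eq_iff sswap_def)
  ultimately show ?thesis by (elim disjE conjE) simp_all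
qed

section \<open>Reflections and the absolute length\<close>

context type_D_system
begin

abbreviation T :: "'a set" where "T \<equiv> reflections G {..<n} s"
abbreviation rlen :: "'a \<Rightarrow> nat" where "rlen \<equiv> word_length G T"

lemma T_closed: "t \<in> T \<Longrightarrow> t \<in> carrier G"
  using reflections_closed by blast

lemma phi_conj:
  assumes "g \<in> carrier G" "t \<in> carrier G" "phi t = sswap a b"
  shows "phi (g \<otimes> t \<otimes> inv g) = sswap (phi g a) (phi g b)"
proof -
  have "phi (g \<otimes> t \<otimes> inv g) = (phi g \<circ> sswap a b) \<circ> phi (inv g)"
    using assms by (simp add: phi_mult o_assoc del: comp_apply)
  also have "\<dots> = sswap (phi g a) (phi g b) \<circ> (phi g \<circ> phi (inv g))"
    by (simp only: signed_perm_sswap_conj[OF signed_perm_phi[OF assms(1)]] o_assoc)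
  finally show ?thesis using phi_inv(2)[OF assms(1)] by simp
qed

lemma phi_reflection:
  assumes "t \<in> T"
  obtains a b where "(a, b) \<in> roots n" "phi t = sswap a b"
proof -
  from assms obtain g k where g: "g \<in> carrier G" "k < n" "t = g \<otimes> s k \<otimes> inv g"
    by (auto simp: reflections_def)
  then have "phi t = sswap (phi g (root_fst n k)) (phi g (root_snd n k))"
    using phi_conj[OF g(1) simple_closed, of k] by (simp add: phi_simple simple_perm_def)
  moreover have "(phi g (root_fst n k), phi g (root_snd n k)) \<in> roots n"
    using g signed_perm_roots[OF signed_perm_phi] simple_root[OF n4] by blast
  ultimately show thesis using that by blast
qed

lemma reflections_conj:
  assumes "t \<in> T" "g \<in> carrier G"
  shows "g \<otimes> t \<otimes> inv g \<in> T"
proof -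
  from assms(1) obtain h k where h: "h \<in> carrier G" "k < n" "t = h \<otimes> s k \<otimes> inv h"
    by (auto simp: reflections_def)
  then have "g \<otimes> t \<otimes> inv g = (g \<otimes> h) \<otimes> s k \<otimes> inv (g \<otimes> h)"
    using assms(2) simple_closed by (simp add: inv_mult_group m_assoc)
  then show ?thesis using h assms(2) unfolding reflections_def by blast
qed

lemma ex_reflection_pos:
  assumes "1 \<le> i" "i < j" "j \<le> n"
  shows "\<exists>t \<in> T. phi t = sswap (int j) (int i)"
  using assms(2,3)
proof (induction j)
  case (Suc j)
  have step: "\<exists>t \<in> T. phi t = sswap (int (Suc j)) (int j)" if "1 \<le> j"
  proof -
    let ?k = "n - Suc j"
    have "?k < n" "?k \<noteq> n - 1" using Suc.prems that by auto
    moreover have "int n - int ?k = int (Suc j)" using Suc.prems by simp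
    ultimately have "phi (s ?k) = sswap (int (Suc j)) (int j)" "s ?k \<in> T"
      using simple_reflection by (auto simp: phi_simple simple_perm_def root_fst_def root_snd_def)
    then show ?thesis by blast
  qed
  show ?case
  proof (cases "i = j")
    case True
    then show ?thesis using step assms(1) by simp
  next
    case False
    then have ij: "i < j" using Suc by simp
    obtain t where t: "t \<in> T" "phi t = sswap (int j) (int i)" using Suc ij by auto
    obtain u where u: "u \<in> T" "phi u = sswap (int (Suc j)) (int j)" using step ij by auto
    have "sswap (int (Suc j)) (int j) (int j) = int (Suc j)" "sswap (int (Suc j)) (int j) (int i) = int i"
      using ij assms(1) by (auto simp: sswap_def)
    then have "phi (u \<otimes> t \<otimes> inv u) = sswap (int (Suc j)) (int i)"
      using phi_conj[OF T_closed[OF u(1)] T_closed[OF t(1)] t(2)] u(2) by simp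
    then show ?thesis using reflections_conj[OF t(1) T_closed[OF u(1)]] by blast
  qed
qed simp

text \<open>Conjugation by reflections reaches every root. The differences \<open>e_j - e_i\<close>
  are already available; the first sum \<open>e_2 + e_1\<close> is the last simple root, and the
  other sums are obtained by replacing \<open>2\<close> and then \<open>1\<close> by other
  letters.\<close>

lemma ex_reflection:
  assumes "(a, b) \<in> roots n"
  shows "\<exists>t \<in> T. phi t = sswap a b"
proof -
  define R where "R a b \<longleftrightarrow> (a, b) \<in> roots n \<and> (\<exists>t \<in> T. phi t = sswap a b)" for a b
  have comm: "R b a" if "R a b" for a b
  proof -
    have r: "(a, b) \<in> roots n" using that by (simp add: R_def)
    then have "(b, a) \<in> roots n" by (auto simp: roots_def)
    then show ?thesis using that unfolding R_def sswap_commute[OF rootsD(3-5)[OF r]] by blast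
  qed
  have neg: "R (- a) (- b)" if "R a b" for a b
  proof -
    have r: "(a, b) \<in> roots n" using that by (simp add: R_def)
    then have "(- a, - b) \<in> roots n" by (auto simp: roots_def)
    then show ?thesis using that unfolding R_def sswap_uminus[OF rootsD(3-5)[OF r]] by blast
  qed
  have conj: "R (sswap a b c) (sswap a b d)" if "R a b" "R c d" for a b c d
  proof -
    from that obtain t u where t: "t \<in> T" "phi t = sswap a b" and u: "u \<in> T" "phi u = sswap c d"
      by (auto simp: R_def)
    have "phi (t \<otimes> u \<otimes> inv t) = sswap (sswap a b c) (sswap a b d)"
      using phi_conj[OF T_closed[OF t(1)] T_closed[OF u(1)] u(2)] t(2) by simp
    moreover have "t \<otimes> u \<otimes> inv t \<in> T" by (rule reflections_conj[OF u(1) T_closed[OF t(1)]])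
    moreover have "(sswap a b c, sswap a b d) \<in> roots n"
      using that signed_perm_roots[OF signed_perm_sswap] by (auto simp: R_def)
    ultimately show ?thesis by (auto simp: R_def)
  qed
  have pos': "R j i" if "1 \<le> i" "i < j" "j \<le> int n" for i j :: int
    using ex_reflection_pos[of "nat i" "nat j"] that by (auto simp: R_def roots_def pts_def)
  have pos: "R i j" if "1 \<le> i" "1 \<le> j" "i \<noteq> j" "i \<le> int n" "j \<le> int n" for i j
    using that pos' comm by (cases "i < j") auto
  have r2: "R 2 (- 1)"
  proof -
    have "s (n - 1) \<in> T" "phi (s (n - 1)) = sswap 2 (- 1)"
      using simple_reflection n4 by (auto simp: phi_simple simple_perm_def root_fst_def root_snd_def)
    then show ?thesis using n4 by (auto simp: R_def roots_def pts_def)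
  qed
  have r1: "R j (- 1)" if "2 \<le> j" "j \<le> int n" for j
  proof (cases "j = 2")
    case False
    have "R (sswap j 2 2) (sswap j 2 (- 1))" using that False by (intro conj r2 pos) auto
    then show ?thesis using that False by (simp add: sswap_def)
  qed (use r2 in simp)
  have mixed: "R j (- i)" if "1 \<le> i" "1 \<le> j" "i \<noteq> j" "i \<le> int n" "j \<le> int n" for i j
  proof -
    consider "i = 1" | "j = 1" "i \<noteq> 1" | "i \<noteq> 1" "j \<noteq> 1" by blast
    then show ?thesis
    proof cases
      case 1
      then show ?thesis using r1 that by simp
    next
      case 2
      then have "R (- i) (- (- 1))" using that by (intro neg r1) auto
      then show ?thesis using comm 2 by simp
    next
      case 3
      have "R (sswap i 1 j) (sswap i 1 (- 1))" using that 3 by (intro conj pos r1) auto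
      then show ?thesis using that 3 by (simp add: sswap_def)
    qed
  qed
  have "R a b"
  proof -
    have ab: "a \<noteq> 0" "b \<noteq> 0" "\<bar>a\<bar> \<le> int n" "\<bar>b\<bar> \<le> int n" "\<bar>a\<bar> \<noteq> \<bar>b\<bar>"
      using assms by (auto simp: roots_def pts_def)
    consider "a > 0" "b > 0" | "a > 0" "b < 0" | "a < 0" "b > 0" | "a < 0" "b < 0"
      using ab by linarith
    then show ?thesis
    proof cases
      case 1
      then show ?thesis using ab by (intro pos) auto
    next
      case 2
      then have "R a (- (- b))" using ab by (intro mixed) auto
      then show ?thesis by simp
    next
      case 3
      then have "R b (- (- a))" using ab by (intro mixed) auto
      then show ?thesis using comm by simp
    next
      case 4
      then have "R (- (- a)) (- (- b))" using ab by (intro neg pos) auto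
      then show ?thesis by simp
    qed
  qed
  then show ?thesis by (simp add: R_def)
qed

lemma T_list_closed: "ts \<in> lists T \<Longrightarrow> ts \<in> lists (carrier G)"
  using reflections_closed by auto

section \<open>Absolute length through lists of roots\<close>

text \<open>The last conjunct keeps track of single factors; it later turns generation by the
  factors into transitivity on the signed points.\<close>

lemma reflections_to_roots:
  assumes "ts \<in> lists T"
  shows "\<exists>ps. set ps \<subseteq> roots n \<and> length ps = length ts \<and> phi (list_mult G ts) = rprod ps
    \<and> (\<forall>t \<in> set ts. \<exists>(a, b) \<in> set ps. phi t = sswap a b)"
  using assms
proof (induction ts)
  case Nil
  then show ?case by (intro exI[of _ "[]"]) (simp add: phi_one)
next
  case (Cons t ts)
  then obtain ps where ps: "set ps \<subseteq> roots n" "length ps = length ts" "phi (list_mult G ts) = rprod ps"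
    "\<forall>t \<in> set ts. \<exists>(a, b) \<in> set ps. phi t = sswap a b" by auto
  have tT: "t \<in> T" "ts \<in> lists T" using Cons by auto
  obtain a b where ab: "(a, b) \<in> roots n" "phi t = sswap a b" by (rule phi_reflection[OF tT(1)])
  have "phi (list_mult G (t # ts)) = rprod ((a, b) # ps)"
    using tT T_closed list_mult_closed[OF T_list_closed, of ts] ab ps(3)
    by (simp add: phi_mult del: comp_apply)
  then show ?case using ps ab by (intro exI[of _ "(a, b) # ps"]) auto
qed

lemma roots_to_reflections:
  assumes "set ps \<subseteq> roots n"
  shows "\<exists>ts \<in> lists T. length ts = length ps \<and> phi (list_mult G ts) = rprod ps"
  using assms
proof (induction ps)
  case Nil
  then show ?case by (intro bexI[of _ "[]"]) (simp_all add: phi_one)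
next
  case (Cons p ps)
  then obtain ts where ts: "ts \<in> lists T" "length ts = length ps" "phi (list_mult G ts) = rprod ps" by auto
  obtain t where t: "t \<in> T" "phi t = sswap (fst p) (snd p)"
    using ex_reflection[of "fst p" "snd p"] Cons.prems by auto
  have "phi (list_mult G (t # ts)) = rprod (p # ps)"
    using t T_closed list_mult_closed[OF T_list_closed, of ts] ts by (simp add: phi_mult del: comp_apply)
  then show ?case using ts t by (intro bexI[of _ "t # ts"]) auto
qed

lemma ex_rprod:
  assumes "set ps \<subseteq> roots n"
  obtains g where "g \<in> carrier G" "phi g = rprod ps"
  using roots_to_reflections[OF assms] list_mult_closed T_list_closed by blast

text \<open>Faithfulness enters here: a factorization of the permutation lifts to reflections whose
  product has the same image as \<open>g\<close>, hence equals \<open>g\<close>.\<close>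

lemma rlen_le:
  assumes "g \<in> carrier G" "set ps \<subseteq> roots n" "phi g = rprod ps"
  shows "rlen g \<le> length ps"
proof -
  obtain ts where ts: "ts \<in> lists T" "length ts = length ps" "phi (list_mult G ts) = rprod ps"
    using roots_to_reflections[OF assms(2)] by blast
  then have "list_mult G ts = g" using assms by (intro phi_inj list_mult_closed T_list_closed) auto
  then show ?thesis
    unfolding word_length_def ts(2)[symmetric] using ts(1) by (intro Least_le) blast
qed

lemma rlen_word:
  assumes "g \<in> carrier G"
  obtains ps where "set ps \<subseteq> roots n" "length ps = rlen g" "phi g = rprod ps"
proof -
  have "\<exists>ts \<in> lists T. length ts = rlen g \<and> list_mult G ts = g"
    unfolding word_length_def by (rule LeastI_ex) (use reflections_generate[OF assms] in blast)
  then show thesis using reflections_to_roots that by metis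
qed

lemma rlen_zero: "g \<in> carrier G \<Longrightarrow> rlen g = 0 \<Longrightarrow> g = \<one>"
  using rlen_word[of g] phi_kernel[of g] by (metis length_0_conv rprod_simps(1))

lemma rlen_mult_le:
  assumes "g \<in> carrier G" "h \<in> carrier G"
  shows "rlen (g \<otimes> h) \<le> rlen g + rlen h"
proof -
  obtain ps where ps: "set ps \<subseteq> roots n" "length ps = rlen g" "phi g = rprod ps"
    using rlen_word[OF assms(1)] .
  obtain qs where qs: "set qs \<subseteq> roots n" "length qs = rlen h" "phi h = rprod qs"
    using rlen_word[OF assms(2)] .
  have "rlen (g \<otimes> h) \<le> length (ps @ qs)"
    using assms ps qs by (intro rlen_le) (auto simp: phi_mult rprod_append)
  then show ?thesis using ps qs by simp
qed

text \<open>Cancelling \<open>v\<close> from \<open>A @ B @ C\<close> leaves the roots of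
  \<open>A\<close>, moved by the inverse of \<open>v\<close>, followed by \<open>C\<close>.
  Subadditivity then forces equality in both length estimates, since the whole factorization is
  shortest.\<close>

lemma factor_absolute_le:
  assumes u: "u \<in> carrier G" "phi u = rprod (A @ B @ C)" "rlen u = length A + length B + length C"
    and v: "v \<in> carrier G" "phi v = rprod B"
    and r: "set A \<subseteq> roots n" "set B \<subseteq> roots n" "set C \<subseteq> roots n"
  shows "rlen v = length B" "absolute_le G T v u"
proof -
  let ?h = "phi (inv v)"
  have h: "signed_perm n ?h" using v by (intro signed_perm_phi) simp
  have "phi (inv v \<otimes> u) = ?h \<circ> rprod A \<circ> rprod B \<circ> rprod C"
    using u v by (simp add: phi_mult rprod_append o_assoc del: comp_apply)
  also have "\<dots> = rprod (map (map_prod ?h ?h) A) \<circ> (?h \<circ> phi v) \<circ> rprod C"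
    by (simp only: rprod_conj[OF h, of A] v(2) o_assoc)
  also have "\<dots> = rprod (map (map_prod ?h ?h) A @ C)"
    using phi_inv(1)[OF v(1)] by (simp add: rprod_append del: comp_apply)
  finally have "rlen (inv v \<otimes> u) \<le> length (map (map_prod ?h ?h) A @ C)"
    using u v r map_prod_roots[OF h r(1)] by (intro rlen_le) auto
  moreover have "rlen v \<le> length B" by (rule rlen_le[OF v(1) r(2) v(2)])
  moreover have "rlen u \<le> rlen v + rlen (inv v \<otimes> u)"
    using rlen_mult_le[of v "inv v \<otimes> u"] u(1) v(1) by (simp flip: m_assoc)
  ultimately show "rlen v = length B" "absolute_le G T v u"
    using u(3) by (auto simp: absolute_le_def)
qed

section \<open>Cycle type of quasi-Coxeter elements\<close>

lemma phi_generate_related: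
  assumes g: "g \<in> generate G S" and S: "S \<subseteq> carrier G"
    and E: "equiv UNIV E" "\<And>t z. t \<in> S \<Longrightarrow> (z, phi t z) \<in> E"
  shows "(z, phi g z) \<in> E"
  using g
proof (induction arbitrary: z rule: generate.induct)
  case one
  then show ?case using equivD(1)[OF E(1)] by (simp add: phi_one)
next
  case (inv t)
  then have "phi t (phi (inv t) z) = z"
    using phi_inv(2)[of t] S by (auto simp: fun_eq_iff)
  then show ?case using E(2)[OF inv, of "phi (inv t) z"] equivD(2)[OF E(1), of "phi (inv t) z" z] by simp
next
  case (eng g h)
  then have "g \<in> carrier G" "h \<in> carrier G" using generate_in_carrier[OF S] by auto
  then show ?case using eng.IH(1)[of "phi h z"] eng.IH(2)[of z] equivD(3)[OF E(1), of z "phi h z"]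
    by (simp add: phi_mult)
qed (use E in auto)

lemma carrier_transitive:
  assumes E: "equiv UNIV E" "\<And>g z. g \<in> carrier G \<Longrightarrow> (z, phi g z) \<in> E"
    and xy: "x \<in> pts n" "y \<in> pts n"
  shows "(x, y) \<in> E"
proof -
  have 1: "(x, y) \<in> E" if "x \<in> pts n" "y \<in> pts n" "\<bar>x\<bar> \<noteq> \<bar>y\<bar>" for x y
  proof -
    have r: "(x, y) \<in> roots n" using that by (simp add: roots_def)
    then obtain t where "t \<in> T" "phi t = sswap x y" using ex_reflection by blast
    then show ?thesis using E(2)[of t x] T_closed sswap_apply[OF rootsD(3-5)[OF r]] by auto
  qed
  \<comment> \<open>No reflection maps \<open>x\<close> to \<open>- x\<close>, so a point with
    another absolute value serves as an intermediate stop.\<close>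
  define z :: int where "z = (if \<bar>x\<bar> = 1 then 2 else 1)"
  have z: "z \<in> pts n" "\<bar>x\<bar> \<noteq> \<bar>z\<bar>" using n4 by (auto simp: z_def pts_def)
  show ?thesis
  proof (cases "\<bar>x\<bar> = \<bar>y\<bar>")
    case True
    then show ?thesis using 1[OF xy(1) z] 1[OF z(1) xy(2)] z(2) equivD(3)[OF E(1), of x z y] by simp
  qed (use 1 xy in blast)
qed

text \<open>An equivalence relation respected by the factors is respected by everything they
  generate, here the whole group, which acts transitively; this supplies the hypothesis of
  \<open>num_classes_rprod_le_2\<close>.\<close>

lemma quasi_coxeter_cycles:
  assumes "quasi_coxeter_element G {..<n} s w"
  obtains xs ys where "w \<in> carrier G" "rlen w = n"
    "signed_cycle (phi w) xs (- 1)" "signed_cycle (phi w) ys (- 1)"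
    "distinct (map abs (xs @ ys))" "supp (xs @ ys) = pts n"
proof -
  from assms obtain ts where w: "w \<in> carrier G" and ts: "ts \<in> lists T" "list_mult G ts = w"
    "length ts = rlen w" "length ts = n" "generate G (set ts) = carrier G"
    by (auto simp: quasi_coxeter_element_def reduced_decomposition_def)
  obtain ps where ps: "set ps \<subseteq> roots n" "length ps = n" "phi w = rprod ps"
    "\<forall>t \<in> set ts. \<exists>(a, b) \<in> set ps. phi t = sswap a b"
    using reflections_to_roots[OF ts(1)] ts(2,4) by auto
  have rw: "rlen w = n" using ts by simp
  have "num_classes (pts n) (orbit_rel (rprod ps)) \<le> 2"
  proof (rule num_classes_rprod_le_2[OF ps(1,2)])
    fix E :: "(int \<times> int) set" and x y
    assume E: "equiv UNIV E" "\<And>a b z. (a, b) \<in> set ps \<Longrightarrow> (z, sswap a b z) \<in> E" and xy: "x \<in> pts n" "y \<in> pts n"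
    have S: "set ts \<subseteq> carrier G" using ts(1) reflections_closed by auto
    have tE: "(z, phi t z) \<in> E" if "t \<in> set ts" for t z
    proof -
      obtain a b where "(a, b) \<in> set ps" "phi t = sswap a b" using ps(4) \<open>t \<in> set ts\<close> by blast
      then show ?thesis using E(2) by simp
    qed
    have "(z, phi g z) \<in> E" if "g \<in> carrier G" for g z
      using phi_generate_related[OF _ S E(1) tE, of g z] ts(5) that by simp
    then show "(x, y) \<in> E" by (rule carrier_transitive[OF E(1) _ xy])
  qed
  moreover have "phi w \<noteq> rprod qs" if "set qs \<subseteq> roots n" "length qs = n - 1" for qs
    using rlen_le[OF w that(1)] that(2) rw n4 by auto
  ultimately show thesis
    using two_negative_cycles[of n "phi w"] sign_rprod[OF ps(1)] ps(3) n4 signed_perm_phi[OF w] that[OF w rw]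
    by (metis le_trans one_le_numeral)
qed

text \<open>One absolute value has to be left over in order to absorb a sign.\<close>

lemma ex_relabel:
  assumes zs: "distinct (map abs zs)" "set zs \<subseteq> pts n" "length zs = n" and m: "m \<le> n - 1"
  shows "\<exists>g \<in> carrier G. \<forall>j<m. phi g (int (n - j)) = zs ! j"
  using m
proof (induction m)
  case 0
  then show ?case by (auto intro: bexI[of _ \<one>])
next
  case (Suc m)
  then obtain g where g: "g \<in> carrier G" "\<And>j. j < m \<Longrightarrow> phi g (int (n - j)) = zs ! j" by auto
  note sg = signed_perm_phi[OF g(1)]
  let ?c = "phi g (int (n - m))" and ?z = "zs ! m"
  have c: "?c \<in> pts n" using Suc.prems n4 by (simp add: signed_perm_pts[OF sg]) (simp add: pts_def)
  have z: "?z \<in> pts n" using Suc.prems n4 zs by (simp add: subset_iff)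
  have cj: "\<bar>zs ! j\<bar> \<noteq> \<bar>?c\<bar>" if "j < m" for j
    using that Suc.prems unfolding g(2)[OF that, symmetric] signed_perm_abs[OF sg] by auto
  have zj: "\<bar>zs ! j\<bar> \<noteq> \<bar>?z\<bar>" if "j < m" for j
    using that Suc.prems zs(1,3) n4 by (auto simp: distinct_conv_nth)
  have "\<exists>r \<in> carrier G. phi r ?c = ?z \<and> (\<forall>j<m. phi r (zs ! j) = zs ! j)"
  proof -
    consider "\<bar>?c\<bar> \<noteq> \<bar>?z\<bar>" | "?c = ?z" | "?c = - ?z" "\<bar>?c\<bar> = \<bar>?z\<bar>" by (metis abs_eq_iff)
    then show ?thesis
    proof cases
      case 1
      then have "(?c, ?z) \<in> roots n" using c z by (simp add: roots_def)
      then obtain t where "t \<in> T" "phi t = sswap ?c ?z" using ex_reflection by blast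
      moreover have "sswap ?c ?z ?c = ?z" by (simp add: sswap_def)
      ultimately show ?thesis using cj zj by (intro bexI[of _ t] T_closed) (auto simp: sswap_other)
    next
      case 2
      then show ?thesis by (intro bexI[of _ \<one>]) (auto simp: phi_one)
    next
      case 3
      \<comment> \<open>The sign of \<open>?c\<close> is corrected by changing the signs of
        \<open>?c\<close> and of the next target, which has not been assigned yet; it exists because
        \<open>Suc m \<le> n - 1\<close>.\<close>
      let ?d = "zs ! Suc m"
      have d: "?d \<in> pts n" using Suc.prems n4 zs by (simp add: subset_iff)
      have dj: "\<bar>zs ! j\<bar> \<noteq> \<bar>?d\<bar>" if "j < Suc m" for j
        using that Suc.prems zs(1,3) n4 by (auto simp: distinct_conv_nth)
      have cd: "?c \<noteq> 0" "?d \<noteq> 0" "\<bar>?c\<bar> \<noteq> \<bar>?d\<bar>" using c d dj[of m] 3 by (auto simp: pts_def)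
      then have "set [(?c, ?d), (?c, - ?d)] \<subseteq> roots n" using c d by (auto simp: roots_def)
      then obtain r where r: "r \<in> carrier G" "phi r = rprod [(?c, ?d), (?c, - ?d)]" by (rule ex_rprod)
      have "phi r ?c = ?z" unfolding r(2) using cd 3 by (simp add: sswap_def)
      moreover have "phi r (zs ! j) = zs ! j" if "j < m" for j
        unfolding r(2) using that cj dj[of j] by (simp add: sswap_other)
      ultimately show ?thesis using r(1) by blast
    qed
  qed
  then obtain r where r: "r \<in> carrier G" "phi r ?c = ?z" "\<And>j. j < m \<Longrightarrow> phi r (zs ! j) = zs ! j" by blast
  then have "phi (r \<otimes> g) (int (n - j)) = zs ! j" if "j < Suc m" for j
    using that g by (cases "j = m") (auto simp: phi_mult)
  then show ?case using r g by (intro bexI[of _ "r \<otimes> g"]) auto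
qed

lemma act_conv_rprod: "act n is = rprod (map (\<lambda>k. (root_fst n k, root_snd n k)) is)"
  by (induction "is") (simp_all add: simple_perm_def del: comp_apply)

text \<open>A relabelling carries the simple roots, in their order, to the roots of a factorization
  of \<open>w\<close>: the path \<open>0, \<dots>, n - 3\<close> becomes the chain of
  \<open>ys\<close>, and the fork becomes the sign change of \<open>a\<close> and the last letter of
  \<open>ys\<close>. So \<open>w\<close> is conjugate to the product of all simple
  reflections.\<close>

lemma coxeter_element_of_fixed_negative:
  assumes w: "w \<in> carrier G" and cyc: "signed_cycle (phi w) [a] (- 1)" "signed_cycle (phi w) ys (- 1)"
    and d: "distinct (map abs ([a] @ ys))" and s: "supp ([a] @ ys) = pts n"
  shows "coxeter_element G {..<n} s w"
proof -
  note tc = two_cycles_rprod[OF signed_perm_phi[OF w] cyc d s]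
  let ?b = "last ys"
  have ne: "ys \<noteq> []" using cyc(2) by (simp add: signed_cycle_def)
  have w_eq: "phi w = rprod (chain ys @ [(a, ?b), (a, - ?b)])" using tc(1) by simp
  have ly: "length ys = n - 1" using tc(3) ne by (cases ys) auto
  let ?zs = "ys @ [a]"
  have sub: "set ?zs \<subseteq> pts n" unfolding s[symmetric] subset_iff supp_iff by auto
  have dz: "distinct (map abs ?zs)" using d by auto
  have lz: "length ?zs = n" using ly n4 by simp
  obtain g where g: "g \<in> carrier G" "\<And>j. j < n - 1 \<Longrightarrow> phi g (int (n - j)) = ?zs ! j"
    using ex_relabel[OF dz sub lz order.refl] by blast
  note sg = signed_perm_phi[OF g(1)]
  have gj: "phi g (int n - int j) = ys ! j" if "j < n - 1" for j
    using g(2)[OF that] that ly by (simp add: nth_append of_nat_diff)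
  have b: "?b = ys ! (n - 2)" using ly ne by (simp add: last_conv_nth numeral_2_eq_2)
  have g2: "phi g 2 = ?b" using gj[of "n - 2"] n4 b by (simp add: of_nat_diff)
  have g1: "phi g 1 = a \<or> phi g 1 = - a"
  proof -
    have "phi g 1 \<in> supp ?zs"
      using s n4 by (simp add: Un_commute Un_left_commute signed_perm_pts[OF sg]) (simp add: pts_def)
    moreover have "phi g 1 \<notin> supp ys"
    proof
      assume "phi g 1 \<in> supp ys"
      then obtain y where "y \<in> set ys" "\<bar>phi g 1\<bar> = \<bar>y\<bar>" by (auto simp: supp_def)
      then obtain j where j: "j < n - 1" "\<bar>phi g 1\<bar> = \<bar>ys ! j\<bar>" using ly by (auto simp: in_set_conv_nth)
      then have "\<bar>phi g 1\<bar> = \<bar>phi g (int n - int j)\<bar>" using gj by simp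
      then show False using j(1) unfolding signed_perm_abs[OF sg] by simp
    qed
    ultimately show ?thesis by simp
  qed
  let ?h = "map_prod (phi g) (phi g)"
  let ?qs = "map (\<lambda>k. (root_fst n k, root_snd n k)) [0..<n]"
  have upt: "[0..<n] = [0..<n - 2] @ [n - 2, n - 1]"
  proof -
    obtain m where "n = Suc (Suc m)" using n4 by (metis add_2_eq_Suc le_Suc_ex numeral_Bit0 add.assoc)
    then show ?thesis by simp
  qed
  have "map ?h ?qs = chain ys @ [(?b, phi g 1), (?b, - phi g 1)]"
  proof -
    have "map ?h (map (\<lambda>k. (root_fst n k, root_snd n k)) [0..<n - 2]) = chain ys"
      unfolding chain_conv_nth map_map ly
    proof (rule map_cong)
      fix k assume "k \<in> set [0..<n - 1 - 1]"
      then have "k < n - 1" "Suc k < n - 1" by auto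
      then show "(?h \<circ> (\<lambda>k. (root_fst n k, root_snd n k))) k = (ys ! k, ys ! Suc k)"
        using gj[of k] gj[of "Suc k"] by (simp add: root_fst_def root_snd_def algebra_simps)
    qed (simp add: numeral_2_eq_2)
    moreover have "?h (root_fst n (n - 2), root_snd n (n - 2)) = (?b, phi g 1)"
    proof -
      have "n - 2 \<noteq> n - 1" "int n - int (n - 2) = 2" using n4 by auto
      then show ?thesis using g2 by (simp add: root_fst_def root_snd_def)
    qed
    moreover have "?h (root_fst n (n - 1), root_snd n (n - 1)) = (?b, - phi g 1)"
      using n4 g2 signed_perm_odd[OF sg, of 1] by (simp add: root_fst_def root_snd_def)
    ultimately show ?thesis unfolding upt by simp
  qed
  \<comment> \<open>The relabelling controls the image of \<open>1\<close> only up to sign, but the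
    two reflections commute, so both signs give the same product.\<close>
  moreover have "rprod [(?b, phi g 1), (?b, - phi g 1)] = rprod [(a, ?b), (a, - ?b)]"
  proof -
    have "?b \<in> set ys" "a \<in> pts n" using ne sub by auto
    moreover have "\<bar>a\<bar> \<notin> abs ` set ys" using d by simp
    ultimately have "?b \<noteq> 0" "a \<noteq> 0" "\<bar>?b\<bar> \<noteq> \<bar>a\<bar>"
      using sub by (auto simp: pts_def) (metis imageI)
    then have "sswap ?b a = sswap a ?b" "sswap ?b (- a) = sswap a (- ?b)"
      "sswap a ?b \<circ> sswap a (- ?b) = sswap a (- ?b) \<circ> sswap a ?b"
      by (auto simp: fun_eq_iff sswap_def)
    then show ?thesis using g1 by (auto simp del: comp_apply)
  qed
  ultimately have conj: "rprod (map ?h ?qs) = phi w"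
    unfolding w_eq rprod_append by (simp only: rprod_append)
  have is_closed: "[0..<n] \<in> lists {..<n}" by auto
  let ?c = "ev [0..<n]"
  have c: "?c \<in> carrier G" by (rule ev_closed[OF is_closed])
  have "phi (g \<otimes> ?c \<otimes> inv g) = (phi g \<circ> rprod ?qs) \<circ> phi (inv g)"
    using g(1) c by (simp add: phi_mult phi_ev[OF is_closed] act_conv_rprod o_assoc del: comp_apply)
  also have "\<dots> = rprod (map ?h ?qs) \<circ> (phi g \<circ> phi (inv g))"
    by (simp only: rprod_conj[OF sg] o_assoc)
  also have "\<dots> = phi w" unfolding conj phi_inv(2)[OF g(1)] by simp
  finally have "w = g \<otimes> ?c \<otimes> inv g" using w g(1) c by (intro phi_inj) auto
  moreover have "distinct [0..<n]" "set [0..<n] = {..<n}" by auto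
  ultimately show ?thesis unfolding coxeter_element_def using g(1) by blast
qed

end

section \<open>The missing join\<close>

context type_D_system
begin

lemma not_lattice_of_long_cycles:
  assumes w: "w \<in> carrier G" "rlen w = n"
    and cyc: "signed_cycle (phi w) (xs @ [c, a]) (- 1)" "signed_cycle (phi w) (ys @ [d, b]) (- 1)"
    and d: "distinct (map abs ((xs @ [c, a]) @ (ys @ [d, b])))"
    and s: "supp ((xs @ [c, a]) @ (ys @ [d, b])) = pts n"
  shows "\<not> lattice (absolute_interval G T w)"
proof
  assume "lattice (absolute_interval G T w)"
  then interpret L: lattice "absolute_interval G T w" .
  let ?L = "absolute_interval G T w"
  note f = signed_perm_phi[OF w(1)]
  note tc = two_cycles_rprod[OF f cyc d s]
  let ?X = "chain (xs @ [c])" and ?Y = "chain (ys @ [d])"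
  \<comment> \<open>These are the \<open>n - 4\<close> reflections common to all factorizations
    below; \<open>(c, a)\<close> can be moved behind \<open>?Y\<close> because \<open>?Y\<close>
    fixes both letters.\<close>
  define A where "A = ?X @ ?Y"
  have tc': "phi w = rprod (?X @ [(c, a)] @ ?Y @ [(d, b), (a, b), (a, - b)])"
    "set (?X @ [(c, a)] @ ?Y @ [(d, b), (a, b), (a, - b)]) \<subseteq> roots n"
    "length (?X @ [(c, a)] @ ?Y @ [(d, b), (a, b), (a, - b)]) = n"
    using tc by (simp_all only: chain_append2 append_assoc last_appendR last.simps list.distinct if_False if_True
        append_Cons append_Nil) simp_all
  have A: "set A \<subseteq> roots n" "length A + 4 = n" using tc'(2,3) by (auto simp: A_def)
  have mem: "c \<in> pts n" "a \<in> pts n" "d \<in> pts n" "b \<in> pts n" unfolding s[symmetric] by auto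
  then have nz: "c \<noteq> 0" "a \<noteq> 0" "d \<noteq> 0" "b \<noteq> 0" by auto
  have ne: "\<bar>c\<bar> \<noteq> \<bar>a\<bar>" "\<bar>c\<bar> \<noteq> \<bar>d\<bar>" "\<bar>c\<bar> \<noteq> \<bar>b\<bar>" "\<bar>a\<bar> \<noteq> \<bar>d\<bar>" "\<bar>a\<bar> \<noteq> \<bar>b\<bar>" "\<bar>d\<bar> \<noteq> \<bar>b\<bar>"
    using d by auto
  have r: "set [(c, a), (d, b), (a, b), (a, - b), (d, - b), (a, d), (a, - d), (a, - c), (c, b), (c, - b), (c, d), (c, - d)] \<subseteq> roots n"
    using mem ne by (auto simp: roots_def)
  have Yca: "rprod ?Y c = c" "rprod ?Y a = a"
    using distinct_supp_disjoint(1)[OF d, of c] distinct_supp_disjoint(1)[OF d, of a]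
    by (auto intro!: rprod_chain_fix)
  have sY: "signed_perm n (rprod ?Y)" using tc'(2) by (intro signed_perm_rprod) auto
  have "phi w = rprod ?X \<circ> (sswap c a \<circ> rprod ?Y) \<circ> rprod [(d, b), (a, b), (a, - b)]"
    unfolding tc'(1) rprod_append by (simp add: o_assoc del: comp_apply)
  also have "sswap c a \<circ> rprod ?Y = rprod ?Y \<circ> sswap c a"
    using signed_perm_sswap_conj[OF sY, of c a] Yca by simp
  finally have f0: "phi w = rprod A \<circ> rprod [(c, a), (d, b), (a, b), (a, - b)]"
    unfolding A_def rprod_append by (simp add: o_assoc del: comp_apply)
  define Y1 where "Y1 = [(c, a), (a, b), (a, - b)]"
  define Y2 where "Y2 = [(c, a), (a, d), (a, - d)]"
  have f1: "phi w = rprod (A @ Y1 @ [(d, - b)])"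
    unfolding f0 sswap_four_eq(1)[OF nz ne] by (simp add: rprod_append Y1_def o_assoc del: comp_apply)
  have f2: "phi w = rprod (A @ Y2 @ [(d, b)])"
    unfolding f0 sswap_four_eq(2)[OF nz ne] by (simp add: rprod_append Y2_def o_assoc del: comp_apply)
  have Y1': "rprod Y1 = rprod [(a, - c), (c, b), (c, - b)]"
    unfolding Y1_def by (rule sswap_three_eq[OF nz(1,2,4) ne(1,3,5), symmetric])
  have Y2': "rprod Y2 = rprod [(a, - c), (c, d), (c, - d)]"
    unfolding Y2_def by (rule sswap_three_eq[OF nz(1-3) ne(1,2,4), symmetric])
  have rY: "set Y1 \<subseteq> roots n" "set Y2 \<subseteq> roots n" using r by (auto simp: Y1_def Y2_def)
  obtain y1 where y1: "y1 \<in> carrier G" "phi y1 = rprod Y1" using ex_rprod[OF rY(1)] .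
  obtain y2 where y2: "y2 \<in> carrier G" "phi y2 = rprod Y2" using ex_rprod[OF rY(2)] .
  obtain t1 where t1: "t1 \<in> carrier G" "phi t1 = rprod [(c, a)]" using ex_rprod[of "[(c, a)]"] r by auto
  obtain t2 where t2: "t2 \<in> carrier G" "phi t2 = rprod [(a, - c)]" using ex_rprod[of "[(a, - c)]"] r by auto
  have l: "length Y1 = 3" "length Y2 = 3" by (simp_all add: Y1_def Y2_def)
  have y1w: "rlen y1 = 3" "absolute_le G T y1 w"
    using factor_absolute_le[OF w(1) f1 _ y1 A(1) rY(1)] w(2) A(2) r l by auto
  have y2w: "rlen y2 = 3" "absolute_le G T y2 w"
    using factor_absolute_le[OF w(1) f2 _ y2 A(1) rY(2)] w(2) A(2) r l by auto
  have t1y1: "rlen t1 = 1" "absolute_le G T t1 y1"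
    using factor_absolute_le[of y1 "[]" "[(c, a)]" "[(a, b), (a, - b)]" t1] y1 t1 y1w(1) r by (auto simp: Y1_def)
  have t1y2: "absolute_le G T t1 y2"
    using factor_absolute_le[of y2 "[]" "[(c, a)]" "[(a, d), (a, - d)]" t1] y2 t1 y2w(1) r by (auto simp: Y2_def)
  have t2y1: "rlen t2 = 1" "absolute_le G T t2 y1"
    using factor_absolute_le[of y1 "[]" "[(a, - c)]" "[(c, b), (c, - b)]" t2] y1 t2 y1w(1) r
    by (auto simp: Y1' simp del: rprod_simps)
  have t2y2: "absolute_le G T t2 y2"
    using factor_absolute_le[of y2 "[]" "[(a, - c)]" "[(c, d), (c, - d)]" t2] y2 t2 y2w(1) r
    by (auto simp: Y2' simp del: rprod_simps)
  have y1L: "y1 \<in> carrier ?L" and y2L: "y2 \<in> carrier ?L"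
    using y1 y2 y1w y2w by (auto simp: absolute_interval_def)
  have t1L: "t1 \<in> carrier ?L" and t2L: "t2 \<in> carrier ?L"
  proof -

    have f1': "phi w = rprod (A @ [(c, a)] @ [(a, b), (a, - b), (d, - b)])"
      unfolding f1 by (simp add: Y1_def)
    show "t1 \<in> carrier ?L"
      using factor_absolute_le[OF w(1) f1' _ t1 A(1)] w(2) A(2) r t1(1) by (auto simp: absolute_interval_def)
    have f2': "phi w = rprod (A @ [(a, - c)] @ [(c, b), (c, - b), (d, - b)])"
      unfolding f1 rprod_append Y1' by (simp add: o_assoc del: comp_apply)
    show "t2 \<in> carrier ?L"
      using factor_absolute_le[OF w(1) f2' _ t2 A(1)] w(2) A(2) r t2(1) by (auto simp: absolute_interval_def)
  qed
  obtain z where z: "least ?L z (Upper ?L {t1, t2})"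
    using L.sup_of_two_exists[OF t1L t2L] by blast
  then have "z \<in> Upper ?L {t1, t2}" by (rule least_mem)
  then have zc: "z \<in> carrier G" and zw: "absolute_le G T z w"
    and t1z: "absolute_le G T t1 z" and t2z: "absolute_le G T t2 z"
    using t1L t2L by (auto simp: Upper_def absolute_interval_def)
  have "y1 \<in> Upper ?L {t1, t2}" "y2 \<in> Upper ?L {t1, t2}"
    using y1L y2L t1y1 t2y1 t1y2 t2y2 by (auto simp: Upper_def absolute_interval_def)
  then have zy: "absolute_le G T z y1" "absolute_le G T z y2"
    using least_le[OF z] by (auto simp: absolute_interval_def)
  have eqI: "u = v" if "u \<in> carrier G" "v \<in> carrier G" "absolute_le G T u v" "rlen u = rlen v" for u v
  proof -
    have "inv u \<otimes> v = \<one>" using that by (intro rlen_zero) (auto simp: absolute_le_def)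
    then have "u \<otimes> (inv u \<otimes> v) = u" using that by simp
    then show ?thesis using that by (simp flip: m_assoc)
  qed
  have "rlen z \<noteq> 3"
  proof
    assume "rlen z = 3"
    then have "y1 = y2" using eqI[OF zc y1(1) zy(1)] eqI[OF zc y2(1) zy(2)] y1w(1) y2w(1) by simp
    then have "rprod Y1 b = rprod Y2 b" using y1 y2 by metis
    moreover have "sswap a (- b) b = - a" "sswap a b (- a) = - b"
      using nz(2,4) ne(5) by (auto simp: sswap_def)
    then have "rprod Y1 b = - b" using ne(3,5) by (simp add: Y1_def sswap_other)
    moreover have "rprod Y2 b = b" using ne(3,5,6) by (simp add: Y2_def sswap_other)
    ultimately show False using nz by simp
  qed
  moreover have "rlen z \<noteq> 1"
  proof
    assume "rlen z = 1"
    then have "t1 = t2" using eqI[OF t1(1) zc t1z] eqI[OF t2(1) zc t2z] t1y1(1) t2y1(1) by simp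
    then have "sswap c a a = sswap a (- c) a" using t1 t2 by simp
    then show False using nz(1,2) ne(1) by (auto simp: sswap_def split: if_splits)
  qed
  moreover have "1 \<le> rlen z" "rlen z \<le> 3"
    using t1z t1y1(1) zy(1) y1w(1) by (auto simp: absolute_le_def)
  ultimately have lz: "rlen z = 2" by linarith
  \<comment> \<open>In an element of length 2, the complement of a reflection below it has length
    one and is again a reflection.\<close>
  have root1: "\<exists>p q. (p, q) \<in> roots n \<and> phi z = phi t \<circ> sswap p q"
    if "t \<in> carrier G" "absolute_le G T t z" "rlen t = 1" for t
  proof -
    have "inv t \<otimes> z \<in> carrier G" using that zc by simp
    then obtain ps where ps: "set ps \<subseteq> roots n" "length ps = rlen (inv t \<otimes> z)" "phi (inv t \<otimes> z) = rprod ps"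
      by (rule rlen_word)
    have "length ps = 1" using ps(2) that lz by (simp add: absolute_le_def)
    then obtain p where "ps = [p]" by (auto simp: length_Suc_conv)
    moreover have "t \<otimes> (inv t \<otimes> z) = z" using that zc by (simp flip: m_assoc)
    then have "phi z = phi t \<circ> phi (inv t \<otimes> z)"
      using that zc by (metis \<open>inv t \<otimes> z \<in> carrier G\<close> phi_mult)
    ultimately show ?thesis using ps by (intro exI[of _ "fst p"] exI[of _ "snd p"]) (simp del: comp_apply)
  qed
  obtain p q where pq: "(p, q) \<in> roots n" "phi z = sswap c a \<circ> sswap p q"
    using root1[OF t1(1) t1z t1y1(1)] t1(2) by auto
  obtain p' q' where pq': "(p', q') \<in> roots n" "phi z = sswap a (- c) \<circ> sswap p' q'"
    using root1[OF t2(1) t2z t2y1(1)] t2(2) by auto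
  \<comment> \<open>Comparing the two factorizations of \<open>z\<close>, the double sign change of
    \<open>c\<close> and \<open>a\<close> times a reflection is again a reflection, which leaves
    only two candidates.\<close>
  have "sswap p q = (sswap c a \<circ> sswap c a) \<circ> sswap p q"
    using sswap_o_sswap[OF nz(1,2) ne(1)] by simp
  also have "\<dots> = sswap c a \<circ> (sswap a (- c) \<circ> sswap p' q')"
    using pq(2) pq'(2) by (simp only: o_assoc[symmetric])
  finally have "sswap p' q' = sswap a c \<or> sswap p' q' = sswap a (- c)"
    by (rule sswap_flip_sswap[OF nz(1,2) ne(1) rootsD(3-5)[OF pq'(1)]])
  then have zN: "phi z = rprod [(c, a), (a, - c)]"
  proof
    assume "sswap p' q' = sswap a c"
    then show ?thesis using pq'(2) nz(1,2) ne(1) by (auto simp: fun_eq_iff sswap_def)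
  next
    assume "sswap p' q' = sswap a (- c)"
    then have "phi z = rprod []" using pq'(2) sswap_o_sswap[of a "- c"] nz(1,2) ne(1) by simp
    then have "rlen z \<le> 0" using rlen_le[OF zc, of "[]"] by simp
    then show ?thesis using lz by simp
  qed
  have "inv z \<otimes> w \<in> carrier G" using zc w by simp
  then obtain ps where ps: "set ps \<subseteq> roots n" "length ps = rlen (inv z \<otimes> w)" "phi (inv z \<otimes> w) = rprod ps"
    by (rule rlen_word)
  \<comment> \<open>With \<open>n - 2\<close> factors the complement of \<open>z\<close> has at
    least \<open>2n - 2(n - 2) = 4\<close> orbits, against the bound of two for the flipped
    permutation.\<close>
  have lps: "length ps + 2 = n" using zw lz w(2) ps(2) by (simp add: absolute_le_def)
  let ?N = "rprod [(c, a), (a, - c)]"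
  have NN: "?N \<circ> ?N = id" using nz(1,2) ne(1) by (auto simp: fun_eq_iff sswap_def)
  have "phi (inv z) = ?N \<circ> ?N \<circ> phi (inv z)" unfolding NN by simp
  also have "\<dots> = ?N" using phi_inv(2)[OF zc] zN by (simp only: o_assoc[symmetric]) (simp only: comp_id)
  finally have "phi (inv z \<otimes> w) = ?N \<circ> phi w" using zc w by (simp add: phi_mult del: rprod_simps)
  then have "num_classes (pts n) (orbit_rel (rprod ps)) \<le> 2"
    using num_classes_flip_le_2[OF f cyc d s] ps(3) by (simp del: rprod_simps)
  then show False using num_classes_rprod_ge[OF ps(1)] lps by simp
qed

lemma proper_quasi_coxeter_not_lattice:
  assumes "proper_quasi_coxeter_element G {..<n} s w"
  shows "\<not> lattice (absolute_interval G T w)"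
proof -
  obtain xs ys where w: "w \<in> carrier G" "rlen w = n"
    and cyc: "signed_cycle (phi w) xs (- 1)" "signed_cycle (phi w) ys (- 1)"
    and d: "distinct (map abs (xs @ ys))" and s: "supp (xs @ ys) = pts n"
    using assms quasi_coxeter_cycles unfolding proper_quasi_coxeter_element_def by metis
  have nc: "\<not> coxeter_element G {..<n} s w" using assms by (simp add: proper_quasi_coxeter_element_def)
  have d': "distinct (map abs (ys @ xs))" and s': "supp (ys @ xs) = pts n"
    using d s by auto
  have long: "\<exists>us u v. zs = us @ [u, v]" if "zs \<noteq> []" "\<nexists>u. zs = [u]" for zs :: "int list"
    using that by (metis append_Cons append_Nil append_assoc rev_exhaust)
  have "\<nexists>u. xs = [u]" using coxeter_element_of_fixed_negative[OF w(1)] cyc d s nc by blast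
  moreover have "\<nexists>u. ys = [u]" using coxeter_element_of_fixed_negative[OF w(1)] cyc d' s' nc by blast
  moreover have "xs \<noteq> []" "ys \<noteq> []" using cyc by (auto simp: signed_cycle_def)
  ultimately obtain us c a vs e b where "xs = us @ [c, a]" "ys = vs @ [e, b]"
    using long by metis
  then show ?thesis using not_lattice_of_long_cycles[OF w] cyc d s by blast
qed

end

theorem proposition5p6:
  fixes G :: "('a, 'b) monoid_scheme" and s :: "nat \<Rightarrow> 'a" and n :: nat and w :: 'a
  assumes "n \<ge> 4"
    and "coxeter_system G {..<n} (type_D n) s"
    and "proper_quasi_coxeter_element G {..<n} s w"
  shows "\<not> lattice (absolute_interval G (reflections G {..<n} s) w)"
proof -
  interpret type_D_system G n s
    using assms(1,2) by (simp add: type_D_system_def type_D_system_axioms_def)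
  show ?thesis by (rule proper_quasi_coxeter_not_lattice[OF assms(3)])
qed

end
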